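(* Let $\Theta\subset\mathbb{R}^p$ be a nonempty connected open set, $X\subset\mathbb{R}^n$ nonempty closed convex, $Y\subset\mathbb{R}^m$ nonempty convex compact, and $\alpha>0$. For each $\theta\in\Theta$ let $\Phi_\theta:\mathbb{R}^n\times\mathbb{R}^m\to\mathbb{R}$ be continuous such that $\Phi_\theta(\cdot,y)$ is $\alpha$-strongly convex for every $y$ and $-\Phi_\theta(x,\cdot)$ is $\alpha$-strongly convex for every $x$, and assume $\theta\mapsto\Phi_\theta(x,y)$ is Lipschitz on $\Theta$ for all $(x,y)$. Define the operator $\mathcal{A}_\theta$ on $\mathbb{R}^{n}\times\mathbb{R}^m$ by $\mathcal{A}_\theta(x,y)=\big(\partial_x\Phi_\theta(x,y)+N_X(x)\big)\times\big(\partial_y(-\Phi_\theta)(x,y)+N_Y(y)\big)$. Let $\gamma\in(0,1/\alpha)$ and assume that $T(\theta,z):=\mathcal{R}_{\gamma\mathcal{A}_\theta}(z)$ is path differentiable jointly in $(\theta,z)\in\Theta\times\mathbb{R}^{n+m}$. Then for each $\theta$ the min-max problem $\min_{x\in X}\max_{y\in Y}\Phi_\theta(x,y)$ has a unique saddle point $z^\star(\theta)=(x^\star(\theta),y^\star(\theta))$ (the unique zero of $\mathcal{A}_\theta$), and $\theta\mapsto z^\star(\theta)$ is path differentiable on $\Theta$ with conservative Jacobian $$\mathcal{J}_{z^\star}(\theta)=\big\{(\mathrm{Id}_{n+m}-V)^{-1}U:\ [U\ V]\in\mathrm{Jac}^c_T(\theta,z^\star(\theta))\big\},$$ with $U\in\mathbb{R}^{(n+m)\times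 p}$, $V\in\mathbb{R}^{(n+m)\times(n+m)}$.
   Context: $\partial_x\Phi_\theta(x,y)$ is the convex subdifferential of $\Phi_\theta(\cdot,y)$ at $x$, $\partial_y(-\Phi_\theta)(x,y)$ that of $-\Phi_\theta(x,\cdot)$ at $y$; $N_X,N_Y$ are normal cones. The resolvent of a maximal monotone $\mathcal{A}$ is $\mathcal{R}_{\mathcal{A}}=(\mathrm{Id}+\mathcal{A})^{-1}$. Clarke Jacobian: for a locally Lipschitz $F:\mathbb{R}^N\to\mathbb{R}^k$, $\mathrm{Jac}^c_F(z)=\mathrm{conv}\{\lim_j \mathrm{Jac}_F(z_j): z_j\to z,\ F \text{ differentiable at } z_j\}$. A conservative Jacobian for a locally Lipschitz $F$ is a set-valued map $\mathcal{J}_F$ with nonempty values, locally bounded, with closed graph, such that for every absolutely continuous curve $c:[0,1]\to\mathbb{R}^N$, for almost every $t$, $\frac{d}{dt}F(c(t))=M\dot c(t)$ for all $M\in\mathcal{J}_F(c(t))$. $F$ is path differentiable if it is locally Lipschitz and admits a conservative Jacobian. Jacobians of maps of $(\theta,z)$ are written $[U\ V]$ with $U$ the $\theta$-block and $V$ the $z$-block of the joint Jacobian. *)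

theory Defs
  imports "HOL-Analysis.Analysis"
begin

definition strongly_convex :: "real \<Rightarrow> ('a::real_inner \<Rightarrow> real) \<Rightarrow> bool" where
  "strongly_convex \<alpha> f \<longleftrightarrow> convex_on UNIV (\<lambda>x. f x - (\<alpha> / 2) * (norm x)\<^sup>2)"

definition subdiff :: "('a::real_inner \<Rightarrow> real) \<Rightarrow> 'a \<Rightarrow> 'a set" where
  "subdiff f x = {g. \<forall>u. f x + inner g (u - x) \<le> f u}"

definition normal_cone :: "'a::real_inner set \<Rightarrow> 'a \<Rightarrow> 'a set" where
  "normal_cone C x = (if x \<in> C then {v. \<forall>u\<in>C. inner v (u - x) \<le> 0} else {})"

definition set_plus_sets :: "'a::plus set \<Rightarrow> 'a set \<Rightarrow> 'a set" where
  "set_plus_sets A B = {a + b | a b. a \<in> A \<and> b \<in> B}"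

definition saddle_operator ::
  "'n::real_inner set \<Rightarrow> 'm::real_inner set \<Rightarrow> ('n \<Rightarrow> 'm \<Rightarrow> real) \<Rightarrow> 'n \<times> 'm \<Rightarrow> ('n \<times> 'm) set" where
  "saddle_operator X Y \<Phi> z =
     set_plus_sets (subdiff (\<lambda>x. \<Phi> x (snd z)) (fst z)) (normal_cone X (fst z)) \<times>
     set_plus_sets (subdiff (\<lambda>y. - \<Phi> (fst z) y) (snd z)) (normal_cone Y (snd z))"

definition resolvent :: "('a::real_vector \<Rightarrow> 'a set) \<Rightarrow> 'a \<Rightarrow> 'a set" where
  "resolvent A z = {w. z \<in> (\<lambda>a. w + a) ` A w}"

definition scale_op :: "real \<Rightarrow> ('a::real_vector \<Rightarrow> 'a set) \<Rightarrow> 'a \<Rightarrow> 'a set" where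
  "scale_op \<gamma> A w = (\<lambda>a. \<gamma> *\<^sub>R a) ` A w"

definition resolvent_fun :: "('a::real_vector \<Rightarrow> 'a set) \<Rightarrow> 'a \<Rightarrow> 'a" where
  "resolvent_fun A z = (THE w. w \<in> resolvent A z)"

definition is_saddle_point ::
  "'n set \<Rightarrow> 'm set \<Rightarrow> ('n \<Rightarrow> 'm \<Rightarrow> real) \<Rightarrow> 'n \<times> 'm \<Rightarrow> bool" where
  "is_saddle_point X Y \<Phi> z \<longleftrightarrow> fst z \<in> X \<and> snd z \<in> Y \<and>
     (\<forall>x\<in>X. \<forall>y\<in>Y. \<Phi> (fst z) y \<le> \<Phi> (fst z) (snd z) \<and> \<Phi> (fst z) (snd z) \<le> \<Phi> x (snd z))"

definition abs_continuous_on :: "real set \<Rightarrow> (real \<Rightarrow> 'a::real_normed_vector) \<Rightarrow> bool" where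
  "abs_continuous_on S c \<longleftrightarrow>
    (\<forall>\<epsilon>>0. \<exists>\<delta>>0. \<forall>(n::nat) (a::nat \<Rightarrow> real) b.
       (\<forall>i<n. a i \<le> b i \<and> {a i..b i} \<subseteq> S) \<and>
       (\<forall>i<n. \<forall>j<n. i \<noteq> j \<longrightarrow> {a i<..<b i} \<inter> {a j<..<b j} = {}) \<and>
       (\<Sum>i<n. b i - a i) < \<delta> \<longrightarrow>
       (\<Sum>i<n. norm (c (b i) - c (a i))) < \<epsilon>)"

definition locally_lipschitz_on :: "'a::metric_space set \<Rightarrow> ('a \<Rightarrow> 'b::metric_space) \<Rightarrow> bool" where
  "locally_lipschitz_on D F \<longleftrightarrow> (\<forall>z\<in>D. \<exists>e>0. \<exists>L. L-lipschitz_on (ball z e \<inter> D) F)"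

definition conservative_jacobian_on ::
  "'a::euclidean_space set \<Rightarrow> ('a \<Rightarrow> 'b::euclidean_space) \<Rightarrow> ('a \<Rightarrow> ('a \<Rightarrow>\<^sub>L 'b) set) \<Rightarrow> bool" where
  "conservative_jacobian_on D F J \<longleftrightarrow>
     (\<forall>z\<in>D. J z \<noteq> {}) \<and>
     (\<forall>z\<in>D. \<exists>e>0. \<exists>B. \<forall>w\<in>ball z e \<inter> D. \<forall>M\<in>J w. norm M \<le> B) \<and>
     closedin (top_of_set (D \<times> UNIV)) {(z, M). z \<in> D \<and> M \<in> J z} \<and>
     (\<forall>c. abs_continuous_on {0..1} c \<and> c ` {0..1} \<subseteq> D \<longrightarrow>
        (AE t in lborel. t \<in> {0..1} \<longrightarrow>
           (\<exists>c' d. (c has_vector_derivative c') (at t) \<and>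
                   ((F \<circ> c) has_vector_derivative d) (at t) \<and>
                   (\<forall>M\<in>J (c t). d = blinfun_apply M c'))))"

definition path_differentiable_on :: "'a::euclidean_space set \<Rightarrow> ('a \<Rightarrow> 'b::euclidean_space) \<Rightarrow> bool" where
  "path_differentiable_on D F \<longleftrightarrow> locally_lipschitz_on D F \<and> (\<exists>J. conservative_jacobian_on D F J)"

definition clarke_jacobian ::
  "'a::euclidean_space set \<Rightarrow> ('a \<Rightarrow> 'b::euclidean_space) \<Rightarrow> 'a \<Rightarrow> ('a \<Rightarrow>\<^sub>L 'b) set" where
  "clarke_jacobian D F z = convex hull
     {M. \<exists>s Ms. (\<forall>j. s j \<in> D \<and> (F has_derivative blinfun_apply (Ms j)) (at (s j))) \<and>
                s \<longlonglongrightarrow> z \<and> Ms \<longlonglongrightarrow> M}"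

definition jac_block_U :: "(('p::real_normed_vector \<times> 'z::real_normed_vector) \<Rightarrow>\<^sub>L 'z) \<Rightarrow> ('p \<Rightarrow>\<^sub>L 'z)" where
  "jac_block_U M = Blinfun (\<lambda>\<theta>. blinfun_apply M (\<theta>, 0))"

definition jac_block_V :: "(('p::real_normed_vector \<times> 'z::real_normed_vector) \<Rightarrow>\<^sub>L 'z) \<Rightarrow> ('z \<Rightarrow>\<^sub>L 'z)" where
  "jac_block_V M = Blinfun (\<lambda>z. blinfun_apply M (0, z))"

definition implicit_jac :: "(('p::real_normed_vector \<times> 'z::real_normed_vector) \<Rightarrow>\<^sub>L 'z) \<Rightarrow> ('p \<Rightarrow>\<^sub>L 'z)" where
  "implicit_jac M = Blinfun (inv (blinfun_apply (id_blinfun - jac_block_V M)) \<circ> blinfun_apply (jac_block_U M))"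

end

theory Submission
  imports Defs
begin

text \<open>
  The operator is strongly monotone, so its resolvent \<open>T \<theta>\<close> is a contraction with factor
  \<open>1 / (1 + \<gamma> * \<alpha>)\<close> whose fixed point is the saddle point \<open>zs \<theta>\<close>. Along an absolutely
  continuous curve \<open>c\<close>, conservativity of \<open>J\<close> for \<open>T\<close> applied to the curve \<open>(c, zs \<circ> c)\<close> shows that
  the derivative \<open>d\<close> of \<open>zs \<circ> c\<close> satisfies \<open>d = M (c', d)\<close> for all \<open>M\<close> in \<open>J\<close>. The same holds
  for all \<open>M\<close> in the Clarke Jacobian: wherever all elements of \<open>J\<close> agree on a vector \<open>v\<close>, closedness
  of the graph and a mean value inequality for Lipschitz curves make \<open>T\<close> strictly differentiable
  in direction \<open>v\<close>, so that every Clarke Jacobian takes the same value on \<open>v\<close>. The contraction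
  property makes \<open>Id - V\<close> invertible, and solving \<open>d = U c' + V d\<close> gives the formula. Density of
  the points of differentiability, which is needed for the Clarke Jacobian to be nonempty,
  follows from Baire's theorem, because \<open>J\<close> is single-valued on a dense \<open>G\<^sub>\<delta>\<close> set.
\<close>

section \<open>Strongly convex functions and subgradients\<close>

text \<open>The argument works one direction at a time. At almost every \<open>t\<close> all of
  \<open>J\<close> takes a single value on the velocity \<open>(c', d)\<close> of the lifted curve,
  and this alone fixes the Clarke Jacobian on that vector, even where \<open>J\<close> is not a
  singleton. Strict differentiability is the right notion because Clarke Jacobians are limits of
  derivatives at points off the curve. The velocity exists because the chain rule for
  \<open>J\<close> also asserts differentiability of the curve; it applies since \<open>zs\<close>
  is locally Lipschitz, which makes the lifted curve absolutely continuous. The fixed point identity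
  then equates the output derivative with the second component of the velocity. The inverse of
  \<open>Id - V\<close> is handled through the equation \<open>w = M (v, w)\<close>, whose unique
  solution is \<open>implicit_jac M\<close> applied to \<open>v\<close>: limits and norm bounds are
  taken in this equation rather than in the inverse.\<close>

lemma norm_convex_comb_sq:
  fixes x y :: "'a::real_inner"
  assumes "u + v = (1::real)"
  shows "(norm (u *\<^sub>R x + v *\<^sub>R y))\<^sup>2
    = u * (norm x)\<^sup>2 + v * (norm y)\<^sup>2 - u * v * (norm (x - y))\<^sup>2"
proof -
  have u: "u = 1 - v" using assms by simp
  show ?thesis
    unfolding u by (simp add: power2_norm_eq_inner algebra_simps inner_commute)
qed

text \<open>Along a segment the squared norm falls short of its chord by exactly
  \<open>u * v\<close> times the squared length, so subtracting \<open>\<alpha> / 2\<close> times it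
  turns convexity into this inequality.\<close>

lemma strongly_convexD:
  assumes "strongly_convex \<alpha> f" "0 \<le> u" "0 \<le> v" "u + v = 1"
  shows "f (u *\<^sub>R x + v *\<^sub>R y) \<le> u * f x + v * f y - \<alpha> / 2 * (u * v * (norm (x - y))\<^sup>2)"
proof -
  have "f (u *\<^sub>R x + v *\<^sub>R y) - \<alpha> / 2 * (norm (u *\<^sub>R x + v *\<^sub>R y))\<^sup>2
      \<le> u * (f x - \<alpha> / 2 * (norm x)\<^sup>2) + v * (f y - \<alpha> / 2 * (norm y)\<^sup>2)"
    using assms unfolding strongly_convex_def convex_on_def by blast
  then show ?thesis
    unfolding norm_convex_comb_sq[OF assms(4)] by (simp add: algebra_simps)
qed

lemma strongly_convexI:
  assumes "\<And>x y u v. 0 \<le> u \<Longrightarrow> 0 \<le> v \<Longrightarrow> u + v = 1 \<Longrightarrow>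
    f (u *\<^sub>R x + v *\<^sub>R y) \<le> u * f x + v * f y - \<alpha> / 2 * (u * v * (norm (x - y))\<^sup>2)"
  shows "strongly_convex \<alpha> f"
  unfolding strongly_convex_def convex_on_def
proof (intro conjI ballI allI impI)
  fix x y and u v :: real assume "0 \<le> u" "0 \<le> v" and uv: "u + v = 1"
  from assms[OF this, of x y]
  show "f (u *\<^sub>R x + v *\<^sub>R y) - \<alpha> / 2 * (norm (u *\<^sub>R x + v *\<^sub>R y))\<^sup>2
      \<le> u * (f x - \<alpha> / 2 * (norm x)\<^sup>2) + v * (f y - \<alpha> / 2 * (norm y)\<^sup>2)"
    unfolding norm_convex_comb_sq[OF uv] by (simp add: algebra_simps)
qed simp

lemma strongly_convex_imp_convex:
  fixes f :: "'a::real_inner \<Rightarrow> real"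
  assumes "strongly_convex \<alpha> f" "\<alpha> \<ge> 0"
  shows "convex_on UNIV f"
  unfolding convex_on_def
proof (intro conjI ballI allI impI)
  fix x y :: 'a and u v :: real assume uv: "0 \<le> u" "0 \<le> v" "u + v = 1"
  have "0 \<le> \<alpha> / 2 * (u * v * (norm (x - y))\<^sup>2)" using uv assms by simp
  then show "f (u *\<^sub>R x + v *\<^sub>R y) \<le> u * f x + v * f y"
    using strongly_convexD[OF assms(1) uv, of x y] by linarith
qed simp

text \<open>The penalty is itself convex. The modulus \<open>\<alpha>\<close> is kept as it is,
  which suffices for the regularised saddle problem.\<close>

lemma strongly_convex_add_sq_dist:
  assumes "strongly_convex \<alpha> f" "c \<ge> 0"
  shows "strongly_convex \<alpha> (\<lambda>x. f x + c * (norm (x - a))\<^sup>2)"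
proof (rule strongly_convexI)
  fix x y and u v :: real assume uv: "0 \<le> u" "0 \<le> v" "u + v = 1"
  have "u *\<^sub>R x + v *\<^sub>R y - a = u *\<^sub>R (x - a) + v *\<^sub>R (y - a)"
    using uv(3) by (simp add: algebra_simps flip: scaleR_add_left)
  then have "(norm (u *\<^sub>R x + v *\<^sub>R y - a))\<^sup>2
      = u * (norm (x - a))\<^sup>2 + v * (norm (y - a))\<^sup>2 - u * v * (norm (x - y))\<^sup>2"
    using norm_convex_comb_sq[OF uv(3), of "x - a" "y - a"] by simp
  then have "(norm (u *\<^sub>R x + v *\<^sub>R y - a))\<^sup>2 \<le> u * (norm (x - a))\<^sup>2 + v * (norm (y - a))\<^sup>2"
    using uv by simp
  from mult_left_mono[OF this assms(2)]
  show "f (u *\<^sub>R x + v *\<^sub>R y) + c * (norm (u *\<^sub>R x + v *\<^sub>R y - a))\<^sup>2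
      \<le> u * (f x + c * (norm (x - a))\<^sup>2) + v * (f y + c * (norm (y - a))\<^sup>2)
        - \<alpha> / 2 * (u * v * (norm (x - y))\<^sup>2)"
    using strongly_convexD[OF assms(1) uv, of x y] by (simp add: algebra_simps)
qed

text \<open>Moving towards the base point along segments makes the quadratic error negligible.\<close>

lemma subdiffI_quadratic_error:
  assumes "convex_on UNIV h"
    and le: "\<And>u. h x + inner g (u - x) - K * (norm (u - x))\<^sup>2 \<le> h u"
  shows "g \<in> subdiff h x"
  unfolding subdiff_def
proof (intro CollectI allI)
  fix u
  have *: "h x + inner g (u - x) - t * (K * (norm (u - x))\<^sup>2) \<le> h u" if t: "0 < t" "t < 1" for t
  proof -
    let ?w = "(1 - t) *\<^sub>R x + t *\<^sub>R u"
    have w: "?w - x = t *\<^sub>R (u - x)" by (simp add: algebra_simps)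
    have "h x + t * inner g (u - x) - K * (t\<^sup>2 * (norm (u - x))\<^sup>2) \<le> h ?w"
      using le[of ?w] unfolding w by (simp add: power_mult_distrib)
    also have "h ?w \<le> (1 - t) * h x + t * h u"
      using assms(1) t unfolding convex_on_def by simp
    finally have "t * (h x + inner g (u - x) - t * (K * (norm (u - x))\<^sup>2)) \<le> t * h u"
      by (simp add: algebra_simps power2_eq_square)
    then show ?thesis using t by simp
  qed
  have "((\<lambda>t. h x + inner g (u - x) - t * (K * (norm (u - x))\<^sup>2)) \<longlongrightarrow>
      h x + inner g (u - x) - 0 * (K * (norm (u - x))\<^sup>2)) (at_right 0)"
    by (intro tendsto_intros)
  moreover have "eventually (\<lambda>t::real. 0 < t \<and> t < 1) (at_right 0)"
    by (auto simp: eventually_at_right_field intro!: exI[of _ 1])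
  then have "eventually (\<lambda>t. h x + inner g (u - x) - t * (K * (norm (u - x))\<^sup>2) \<le> h u) (at_right 0)"
    by eventually_elim (use * in auto)
  ultimately show "h x + inner g (u - x) \<le> h u"
    using tendsto_upperbound[of _ _ "at_right (0::real)"] by fastforce
qed

text \<open>\<open>g - \<alpha> *\<^sub>R x\<close> satisfies the subgradient inequality of the
  convex function \<open>?h\<close> up to a quadratic error. Convexity removes the error, and
  expanding the squares gives the gain.\<close>

lemma subdiff_strongly_convexD:
  assumes "strongly_convex \<alpha> f" "g \<in> subdiff f x"
  shows "f x + inner g (u - x) + \<alpha> / 2 * (norm (u - x))\<^sup>2 \<le> f u"
proof -
  let ?h = "\<lambda>x. f x - \<alpha> / 2 * (norm x)\<^sup>2"
  have id: "(norm u)\<^sup>2 = (norm x)\<^sup>2 + 2 * inner x (u - x) + (norm (u - x))\<^sup>2" for u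
    by (simp add: power2_norm_eq_inner algebra_simps inner_commute)
  have "g - \<alpha> *\<^sub>R x \<in> subdiff ?h x"
  proof (rule subdiffI_quadratic_error[where K = "\<alpha> / 2"])
    show "convex_on UNIV ?h" using assms(1) by (simp add: strongly_convex_def)
    fix u
    have "f x + inner g (u - x) \<le> f u" using assms(2) by (simp add: subdiff_def)
    then show "?h x + inner (g - \<alpha> *\<^sub>R x) (u - x) - \<alpha> / 2 * (norm (u - x))\<^sup>2 \<le> ?h u"
      unfolding id[of u] by (simp add: algebra_simps)
  qed
  then have "?h x + inner (g - \<alpha> *\<^sub>R x) (u - x) \<le> ?h u" by (simp add: subdiff_def)
  then show ?thesis unfolding id[of u] by (simp add: algebra_simps)
qed

text \<open>One half of the sum rule for a smooth quadratic: linearising the penalty costs only a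
  quadratic error, which convexity of \<open>f\<close> absorbs.\<close>

lemma subdiff_add_sq_distD:
  assumes "convex_on UNIV f" "g \<in> subdiff (\<lambda>x. f x + c / 2 * (norm (x - a))\<^sup>2) x"
  shows "g - c *\<^sub>R (x - a) \<in> subdiff f x"
proof (rule subdiffI_quadratic_error[OF assms(1), where K = "c / 2"])
  fix u
  have id: "(norm (u - a))\<^sup>2 = (norm (x - a))\<^sup>2 + 2 * inner (x - a) (u - x) + (norm (u - x))\<^sup>2"
    by (simp add: power2_norm_eq_inner algebra_simps inner_commute)
  have "f x + c / 2 * (norm (x - a))\<^sup>2 + inner g (u - x) \<le> f u + c / 2 * (norm (u - a))\<^sup>2"
    using assms(2) by (simp add: subdiff_def)
  then show "f x + inner (g - c *\<^sub>R (x - a)) (u - x) - c / 2 * (norm (u - x))\<^sup>2 \<le> f u"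
    unfolding id by (simp add: algebra_simps)
qed

text \<open>Separate \<open>C \<times> {0}\<close> from the strict epigraph of
  \<open>f - f x\<close>; minimality of \<open>x\<close> makes them disjoint. After scaling, the
  horizontal part of the separating vector yields both the subgradient and the normal.\<close>

lemma constrained_min_imp_subgradient:
  fixes f :: "'a::euclidean_space \<Rightarrow> real"
  assumes f: "convex_on UNIV f" and C: "convex C" "x \<in> C"
    and min: "\<And>u. u \<in> C \<Longrightarrow> f x \<le> f u"
  obtains g where "g \<in> subdiff f x" "- g \<in> normal_cone C x"
proof -
  let ?A = "C \<times> {0::real}" and ?B = "{(u, t). f u - f x < t}"
  have "convex ?A" using C by (intro convex_Times) auto
  moreover have "convex ?B"
    unfolding convex_def
  proof (intro ballI allI impI, clarsimp)
    fix u s v t and a b :: real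
    assume h: "f u - f x < s" "f v - f x < t" "0 \<le> a" "0 \<le> b" "a + b = 1"
    have "f (a *\<^sub>R u + b *\<^sub>R v) \<le> a * f u + b * f v"
      using f h by (simp add: convex_on_def)
    moreover have "a * (f u - f x) + b * (f v - f x) < a * s + b * t"
    proof (cases "a = 0")
      case True then show ?thesis using h by simp
    next
      case False
      then have "a * (f u - f x) < a * s" using h by simp
      moreover have "b * (f v - f x) \<le> b * t" using h by (intro mult_left_mono) auto
      ultimately show ?thesis by linarith
    qed
    moreover have "a * (f u - f x) + b * (f v - f x) = a * f u + b * f v - f x"
    proof -
      have a: "a = 1 - b" using h by simp
      show ?thesis unfolding a by (simp add: algebra_simps)
    qed
    ultimately show "f (a *\<^sub>R u + b *\<^sub>R v) - f x < a * s + b * t" by linarith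
  qed
  moreover have "?A \<noteq> {}" using C by auto
  moreover have "(x, 1) \<in> ?B" by simp
  then have "?B \<noteq> {}" by blast
  moreover have "?A \<inter> ?B = {}" using min by fastforce
  ultimately obtain ab c where ab: "ab \<noteq> 0" "\<forall>z\<in>?A. inner ab z \<le> c" "\<forall>z\<in>?B. c \<le> inner ab z"
    using separating_hyperplane_sets by metis
  obtain a b where [simp]: "ab = (a, b)" by force
  have A: "inner a v \<le> c" if "v \<in> C" for v using ab(2) that by auto
  have B: "c \<le> inner a u + b * t" if "f u - f x < t" for u t using ab(3) that by auto
  \<comment> \<open>\<open>f\<close> is finite everywhere, so the epigraph projects onto the whole
    space, and a vertical hyperplane would bound \<open>inner a\<close> from below
    everywhere.\<close>
  have "b \<noteq> 0"
  proof
    assume "b = 0"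
    then have *: "c \<le> inner a u" for u using B[of u "f u - f x + 1"] by simp
    have "c \<le> c - 1" if "a \<noteq> 0"
      using *[of "((c - 1) / inner a a) *\<^sub>R a"] that by simp
    then have "a = 0" by fastforce
    then show False using ab(1) \<open>b = 0\<close> by (simp add: zero_prod_def)
  qed
  \<comment> \<open>The epigraph is unbounded upwards; \<open>q\<close> is the height over
    \<open>x\<close> at which the separating functional equals \<open>c - 1\<close>.\<close>
  moreover have "b \<ge> 0"
  proof (rule ccontr)
    assume "\<not> b \<ge> 0"
    define q where "q = (c - 1 - inner a x) / b"
    have "q \<le> 1 + \<bar>q\<bar>" by linarith
    then have "b * (1 + \<bar>q\<bar>) \<le> b * q"
      using \<open>\<not> b \<ge> 0\<close> by (intro mult_left_mono_neg) auto
    moreover have "b * q = c - 1 - inner a x" using \<open>b \<noteq> 0\<close> by (simp add: q_def)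
    moreover have "c \<le> inner a x + b * (1 + \<bar>q\<bar>)" by (intro B) simp
    ultimately show False by linarith
  qed
  ultimately have b: "b > 0" by simp
  have B': "c \<le> inner a u + b * (f u - f x)" for u
  proof (rule field_le_epsilon)
    fix e :: real assume "e > 0"
    then show "c \<le> inner a u + b * (f u - f x) + e"
      using B[of u "f u - f x + e / b"] b by (simp add: algebra_simps)
  qed
  have c: "c = inner a x" using A[OF C(2)] B'[of x] by simp
  show thesis
  proof (rule that[of "- (a /\<^sub>R b)"])
    have "f x + inner (- (a /\<^sub>R b)) (u - x) \<le> f u" for u
    proof -
      have "b * inner (- (a /\<^sub>R b)) (u - x) = - inner a (u - x)" using b by simp
      then have "b * (f x + inner (- (a /\<^sub>R b)) (u - x)) \<le> b * f u"
        using B'[of u] b unfolding c distrib_left by (simp add: algebra_simps)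
      then show ?thesis using b by simp
    qed
    then show "- (a /\<^sub>R b) \<in> subdiff f x" by (simp add: subdiff_def)
    show "- (- (a /\<^sub>R b)) \<in> normal_cone C x"
      using A b C(2) unfolding c normal_cone_def
      by (auto simp: inner_diff_right intro!: mult_left_mono)
  qed
qed

section \<open>Saddle points and resolvents\<close>

text \<open>A subgradient \<open>g\<close> at 0 and strong convexity give a quadratic lower bound in
  \<open>norm x\<close>; completing the square centres it at
  \<open>norm g / \<alpha>\<close>.\<close>

lemma strongly_convex_coercive:
  fixes f :: "'a::euclidean_space \<Rightarrow> real"
  assumes "strongly_convex \<alpha> f" "\<alpha> > 0"
  obtains B where "\<And>x. f x \<ge> B" "\<And>c. bounded {x. f x \<le> c}"
proof -
  \<comment> \<open>A point minimises \<open>f\<close> over its own singleton, so the constrained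
    criterion provides a subgradient.\<close>
  obtain g where g: "g \<in> subdiff f 0"
    using constrained_min_imp_subgradient[of f "{0}" 0]
      strongly_convex_imp_convex[OF assms(1)] assms(2) by auto
  have sq: "f 0 - (norm g)\<^sup>2 / (2 * \<alpha>) + \<alpha> / 2 * (norm x - norm g / \<alpha>)\<^sup>2 \<le> f x" for x
  proof -
    have "f 0 - norm g * norm x + \<alpha> / 2 * (norm x)\<^sup>2 \<le> f x"
      using subdiff_strongly_convexD[OF assms(1) g, of x] Cauchy_Schwarz_ineq2[of g x] by simp
    moreover have "\<alpha> / 2 * (norm x - norm g / \<alpha>)\<^sup>2
        = \<alpha> / 2 * (norm x)\<^sup>2 - norm g * norm x + (norm g)\<^sup>2 / (2 * \<alpha>)"
      using assms(2) by (simp add: power2_eq_square field_simps)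
    ultimately show ?thesis by (simp add: field_simps)
  qed
  define B where "B = f 0 - (norm g)\<^sup>2 / (2 * \<alpha>)"
  have sq: "B + \<alpha> / 2 * (norm x - norm g / \<alpha>)\<^sup>2 \<le> f x" for x
    using sq by (simp add: B_def)
  show thesis
  proof
    show "f x \<ge> B" for x
      using sq[of x] assms(2) by (smt (verit) divide_pos_pos mult_nonneg_nonneg zero_le_power2)
    fix c
    have "norm x \<le> norm g / \<alpha> + sqrt (2 * \<bar>c - B\<bar> / \<alpha>)" if "f x \<le> c" for x
    proof -
      have "\<alpha> / 2 * (norm x - norm g / \<alpha>)\<^sup>2 \<le> \<bar>c - B\<bar>" using sq[of x] that by linarith
      then have "(norm x - norm g / \<alpha>)\<^sup>2 \<le> 2 * \<bar>c - B\<bar> / \<alpha>"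
        using assms(2) by (simp add: pos_le_divide_eq mult.commute)
      then have "norm x - norm g / \<alpha> \<le> sqrt (2 * \<bar>c - B\<bar> / \<alpha>)"
        by (rule real_le_rsqrt)
      then show ?thesis by simp
    qed
    then show "bounded {x. f x \<le> c}" by (auto simp: bounded_iff)
  qed
qed

lemma strongly_convex_minimizer_unique:
  assumes "strongly_convex \<alpha> f" "\<alpha> > 0" "convex C" "x \<in> C" "y \<in> C"
    and "\<And>u. u \<in> C \<Longrightarrow> f x \<le> f u" "\<And>u. u \<in> C \<Longrightarrow> f y \<le> f u"
  shows "x = y"
proof (rule ccontr)
  assume "x \<noteq> y"
  let ?w = "(1/2) *\<^sub>R x + (1/2) *\<^sub>R y"
  have "?w \<in> C" using assms(3-5) unfolding convex_def by force
  then have "f x \<le> f ?w" using assms(6) by blast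
  also have "\<dots> \<le> 1/2 * f x + 1/2 * f y - \<alpha> / 2 * (1/2 * (1/2) * (norm (x - y))\<^sup>2)"
    by (rule strongly_convexD[OF assms(1)]) auto
  also have "f y = f x" using assms(4-7) by (simp add: order_antisym)
  finally have "\<alpha> * (norm (x - y))\<^sup>2 \<le> 0" by simp
  then show False using assms(2) \<open>x \<noteq> y\<close>
    by (simp add: mult_le_0_iff power2_eq_square)
qed

text \<open>Take \<open>x\<close> minimising \<open>\<lambda>x. max y. \<Psi> x y\<close> and \<open>y\<close> the maximiser at \<open>x\<close>. To see that
  \<open>x\<close> minimises \<open>\<Psi> \<cdot> y\<close>, compare with the maximisers along the segment from \<open>x\<close> to a competitor;
  they converge to \<open>y\<close> because the maximiser at \<open>x\<close> is unique.\<close>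

lemma saddle_point_exists:
  fixes \<Psi> :: "'a::euclidean_space \<Rightarrow> 'b::euclidean_space \<Rightarrow> real"
  assumes X: "X \<noteq> {}" "closed X" "convex X" and Y: "Y \<noteq> {}" "compact Y" "convex Y"
    and \<alpha>: "\<alpha> > 0" and cont: "continuous_on UNIV (\<lambda>(x, y). \<Psi> x y)"
    and cx: "\<And>y. strongly_convex \<alpha> (\<lambda>x. \<Psi> x y)"
    and cy: "\<And>x. strongly_convex \<alpha> (\<lambda>y. - \<Psi> x y)"
  obtains z where "is_saddle_point X Y \<Psi> z"
proof -
  have lim: "(\<lambda>k. \<Psi> (u k) (v k)) \<longlonglongrightarrow> \<Psi> a b" if "u \<longlonglongrightarrow> a" "v \<longlonglongrightarrow> b" for u v a b
    using continuous_on_tendsto_compose[OF cont tendsto_Pair[OF that]] by simp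
  have conty: "continuous_on Y (\<Psi> x)" for x
    unfolding continuous_on_sequentially comp_def
    using lim[OF tendsto_const] by blast
  have "\<exists>y\<in>Y. \<forall>y'\<in>Y. \<Psi> x y' \<le> \<Psi> x y" for x
    using continuous_attains_sup[OF Y(2,1) conty] by blast
  then obtain m where m: "m x \<in> Y" and m_max: "\<And>y. y \<in> Y \<Longrightarrow> \<Psi> x y \<le> \<Psi> x (m x)" for x
    by metis
  define G where "G x = \<Psi> x (m x)" for x
  have G: "\<Psi> x y \<le> G x" if "y \<in> Y" for x y using m_max that by (simp add: G_def)
  have m_unique: "y = m x" if "y \<in> Y" "\<And>y'. y' \<in> Y \<Longrightarrow> \<Psi> x y' \<le> \<Psi> x y" for x y
    by (rule strongly_convex_minimizer_unique[OF cy \<alpha> Y(3), of y "m x" x])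
      (use that m m_max in auto)
  obtain y0 where y0: "y0 \<in> Y" using Y by blast
  \<comment> \<open>\<open>X\<close> may be unbounded. The single slice at \<open>y0\<close> lies
    below \<open>G\<close>, and its coercivity makes minimising sequences bounded.\<close>
  obtain B where B: "\<And>x. \<Psi> x y0 \<ge> B" and bdd: "\<And>c. bounded {x. \<Psi> x y0 \<le> c}"
    using strongly_convex_coercive[OF cx \<alpha>] by blast
  have bddb: "bdd_below (G ` X)"
    using B G[OF y0] by (intro bdd_belowI2[of _ B]) (meson order_trans)
  let ?I = "Inf (G ` X)"
  have I: "?I \<le> G x" if "x \<in> X" for x using bddb that by (simp add: cINF_lower)
  have "\<exists>x\<in>X. G x < ?I + 1 / Suc k" for k
    using cInf_lessD[of "G ` X" "?I + 1 / Suc k"] X by auto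
  then obtain u where u: "u k \<in> X" "G (u k) < ?I + 1 / Suc k" for k by metis
  have "bounded (range u)"
  proof (rule bounded_subset[OF bdd[of "?I + 1"]], clarify)
    fix k
    have "\<Psi> (u k) y0 \<le> G (u k)" using G[OF y0] .
    moreover have "1 / real (Suc k) \<le> 1" by simp
    ultimately show "\<Psi> (u k) y0 \<le> ?I + 1" using u(2)[of k] by linarith
  qed
  then obtain x r where r: "strict_mono r" "(u \<circ> r) \<longlonglongrightarrow> x"
    using bounded_imp_convergent_subsequence by blast
  have x: "x \<in> X" using closed_sequentially[OF X(2), of "u \<circ> r" x] u(1) r by simp
  \<comment> \<open>The limit is taken for fixed \<open>y\<close> and the maximum over
    \<open>y\<close> only afterwards: lower semicontinuity of \<open>G\<close>.\<close>
  have "\<Psi> x y \<le> ?I" if "y \<in> Y" for y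
  proof (rule LIMSEQ_le)
    show "(\<lambda>k. \<Psi> ((u \<circ> r) k) y) \<longlonglongrightarrow> \<Psi> x y" by (rule lim[OF r(2) tendsto_const])
    have "(\<lambda>k. ?I + 1 / real (Suc k)) \<longlonglongrightarrow> ?I + 0"
      by (intro tendsto_add tendsto_const) (rule LIMSEQ_Suc[OF lim_1_over_n])
    then show "(\<lambda>k. ?I + 1 / real (Suc (r k))) \<longlonglongrightarrow> ?I"
      using LIMSEQ_subseq_LIMSEQ[OF _ r(1)] by (fastforce simp: comp_def)
    show "\<exists>N. \<forall>k\<ge>N. \<Psi> ((u \<circ> r) k) y \<le> ?I + 1 / real (Suc (r k))"
      using u(2) G[OF that] by (metis comp_apply less_imp_le order_trans)
  qed
  then have Gx: "G x \<le> G x'" if "x' \<in> X" for x'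
    using m I[OF that] unfolding G_def[of x] by (meson order_trans)
  have "\<Psi> x (m x) \<le> \<Psi> x' (m x)" if x': "x' \<in> X" for x'
  proof -
    define t where "t k = 1 / real (Suc k)" for k
    define w where "w k = (1 - t k) *\<^sub>R x + t k *\<^sub>R x'" for k
    have t: "0 < t k" "t k \<le> 1" for k by (auto simp: t_def)
    have "t \<longlonglongrightarrow> 0" unfolding t_def by (rule LIMSEQ_Suc[OF lim_1_over_n])
    then have "w \<longlonglongrightarrow> (1 - 0) *\<^sub>R x + 0 *\<^sub>R x'" unfolding w_def by (intro tendsto_intros)
    then have w_lim: "w \<longlonglongrightarrow> x" by simp
    have w: "w k \<in> X" for k
      using X(3) x x' t[of k] by (simp add: w_def convex_alt)
    \<comment> \<open>\<open>x\<close> minimises \<open>G\<close>, so the value at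
      \<open>w k\<close> is at least \<open>G x\<close>. Convexity splits that value, its part at
      \<open>x\<close> is at most \<open>(1 - t k) * G x\<close>, and the positive factor
      \<open>t k\<close> cancels.\<close>
    have le: "G x \<le> \<Psi> x' (m (w k))" for k
    proof -
      have "G x \<le> \<Psi> (w k) (m (w k))" using Gx[OF w] by (simp add: G_def)
      also have "\<dots> \<le> (1 - t k) * \<Psi> x (m (w k)) + t k * \<Psi> x' (m (w k))"
        using strongly_convex_imp_convex[OF cx] \<alpha> t[of k] unfolding w_def convex_on_def
        by (simp add: less_imp_le)
      also have "(1 - t k) * \<Psi> x (m (w k)) \<le> (1 - t k) * G x"
        using G[OF m] t by (intro mult_left_mono) auto
      finally have "t k * G x \<le> t k * \<Psi> x' (m (w k))" by (simp add: algebra_simps)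
      then show ?thesis using t[of k] by simp
    qed
    obtain y s where s: "y \<in> Y" "strict_mono s" "((\<lambda>k. m (w k)) \<circ> s) \<longlonglongrightarrow> y"
      using Y(2) m unfolding compact_def by metis
    have ws: "(w \<circ> s) \<longlonglongrightarrow> x" by (rule LIMSEQ_subseq_LIMSEQ[OF w_lim s(2)])
    have "\<Psi> x y' \<le> \<Psi> x y" if "y' \<in> Y" for y'
    proof (rule LIMSEQ_le[OF lim[OF ws tendsto_const] lim[OF ws s(3)]])
      show "\<exists>N. \<forall>k\<ge>N. \<Psi> ((w \<circ> s) k) y' \<le> \<Psi> ((w \<circ> s) k) (((\<lambda>k. m (w k)) \<circ> s) k)"
        using m_max[OF that] by simp
    qed
    then have "y = m x" using m_unique s(1) by blast
    moreover have "G x \<le> \<Psi> x' y"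
      by (rule LIMSEQ_le_const[OF lim[OF tendsto_const s(3)]]) (use le in simp)
    ultimately show ?thesis by (simp add: G_def)
  qed
  then have "is_saddle_point X Y \<Psi> (x, m x)"
    using x m m_max by (simp add: is_saddle_point_def)
  then show thesis by (rule that)
qed

text \<open>Each factor of the operator expresses the first-order condition of a constrained convex
  minimisation, of \<open>\<Phi>\<close> in \<open>x\<close> and of \<open>- \<Phi>\<close> in
  \<open>y\<close>; together these are the saddle inequalities.\<close>

lemma zero_in_saddle_operator_iff:
  fixes X :: "'a::euclidean_space set" and Y :: "'b::euclidean_space set"
  assumes "convex X" "convex Y"
    and cx: "\<And>y. convex_on UNIV (\<lambda>x. \<Phi> x y)" and cy: "\<And>x. convex_on UNIV (\<lambda>y. - \<Phi> x y)"
  shows "0 \<in> saddle_operator X Y \<Phi> z \<longleftrightarrow> is_saddle_point X Y \<Phi> z"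
proof -
  obtain x y where [simp]: "z = (x, y)" by force
  have *: "0 \<in> set_plus_sets (subdiff f u) (normal_cone C u) \<longleftrightarrow> u \<in> C \<and> (\<forall>v\<in>C. f u \<le> f v)"
    if that: "convex_on UNIV f" "convex C" for f u and C :: "'c::euclidean_space set"
  proof
    assume "0 \<in> set_plus_sets (subdiff f u) (normal_cone C u)"
    then obtain a b where ab: "0 = a + b" "a \<in> subdiff f u" "b \<in> normal_cone C u"
      by (auto simp: set_plus_sets_def)
    then have "a = - b" by (simp add: eq_neg_iff_add_eq_0)
    with ab have u: "u \<in> C" "\<And>v. v \<in> C \<Longrightarrow> inner a (v - u) \<ge> 0"
      by (auto simp: normal_cone_def split: if_splits)
    moreover have "f u + inner a (v - u) \<le> f v" for v using ab by (simp add: subdiff_def)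
    ultimately have "f u \<le> f v" if "v \<in> C" for v by (smt (verit) that)
    then show "u \<in> C \<and> (\<forall>v\<in>C. f u \<le> f v)" using u by simp
  next
    assume "u \<in> C \<and> (\<forall>v\<in>C. f u \<le> f v)"
    then obtain g where g: "g \<in> subdiff f u" "- g \<in> normal_cone C u"
      using constrained_min_imp_subgradient[OF \<open>convex_on UNIV f\<close> \<open>convex C\<close>] by blast
    have "0 = g + (- g)" by simp
    then show "0 \<in> set_plus_sets (subdiff f u) (normal_cone C u)"
      unfolding set_plus_sets_def using g by blast
  qed
  show ?thesis
    using *[OF cx[of y] assms(1), of x] *[OF cy[of x] assms(2), of y] assms
    by (auto simp: saddle_operator_def is_saddle_point_def zero_prod_def)
qed

text \<open>Add the strong subgradient inequalities of the slices at \<open>y\<close>,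
  \<open>y'\<close>, \<open>x\<close> and \<open>x'\<close>: the values of \<open>\<Phi>\<close> at
  the four corners cancel, and each coordinate collects \<open>\<alpha> / 2\<close> twice.\<close>

lemma saddle_operator_strongly_monotone:
  assumes cx: "\<And>y. strongly_convex \<alpha> (\<lambda>x. \<Phi> x y)" and cy: "\<And>x. strongly_convex \<alpha> (\<lambda>y. - \<Phi> x y)"
    and a: "a \<in> saddle_operator X Y \<Phi> z" and b: "b \<in> saddle_operator X Y \<Phi> w"
  shows "\<alpha> * (norm (z - w))\<^sup>2 \<le> inner (a - b) (z - w)"
proof -
  obtain x y x' y' where [simp]: "z = (x, y)" "w = (x', y')" by (metis surj_pair)
  obtain g n h k where a: "a = (g + n, h + k)"
    "g \<in> subdiff (\<lambda>x. \<Phi> x y) x" "n \<in> normal_cone X x"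
    "h \<in> subdiff (\<lambda>y. - \<Phi> x y) y" "k \<in> normal_cone Y y"
    using a by (auto simp: saddle_operator_def set_plus_sets_def)
  obtain g' n' h' k' where b: "b = (g' + n', h' + k')"
    "g' \<in> subdiff (\<lambda>x. \<Phi> x y') x'" "n' \<in> normal_cone X x'"
    "h' \<in> subdiff (\<lambda>y. - \<Phi> x' y) y'" "k' \<in> normal_cone Y y'"
    using b by (auto simp: saddle_operator_def set_plus_sets_def)
  have n: "inner n (x' - x) \<le> 0" "inner n' (x - x') \<le> 0"
    "inner k (y' - y) \<le> 0" "inner k' (y - y') \<le> 0"
    using a b by (auto simp: normal_cone_def split: if_splits)
  note s = subdiff_strongly_convexD[OF cx a(2), of x'] subdiff_strongly_convexD[OF cx b(2), of x]
    subdiff_strongly_convexD[OF cy a(4), of y'] subdiff_strongly_convexD[OF cy b(4), of y]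
  have sq: "(norm (z - w))\<^sup>2 = (norm (x - x'))\<^sup>2 + (norm (y - y'))\<^sup>2"
    by (simp add: power2_norm_eq_inner)
  have "inner (a - b) (z - w) = - inner g (x' - x) - inner n (x' - x) - inner g' (x - x')
      - inner n' (x - x') - inner h (y' - y) - inner k (y' - y) - inner h' (y - y') - inner k' (y - y')"
    unfolding a(1) b(1) by (simp add: algebra_simps)
  then show ?thesis
    using s n unfolding sq norm_minus_commute[of x' x] norm_minus_commute[of y' y]
    by (simp add: algebra_simps)
qed

text \<open>The resolvent equation at \<open>z0\<close> is the optimality condition of the saddle problem
  regularised by \<open>norm (x - x0)\<^sup>2 / (2 * \<gamma>) - norm (y - y0)\<^sup>2 / (2 * \<gamma>)\<close>.\<close>

lemma saddle_resolvent_exists: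
  fixes \<Phi> :: "'a::euclidean_space \<Rightarrow> 'b::euclidean_space \<Rightarrow> real"
  assumes X: "X \<noteq> {}" "closed X" "convex X" and Y: "Y \<noteq> {}" "compact Y" "convex Y"
    and \<alpha>: "\<alpha> > 0" and cont: "continuous_on UNIV (\<lambda>(x, y). \<Phi> x y)"
    and cx: "\<And>y. strongly_convex \<alpha> (\<lambda>x. \<Phi> x y)"
    and cy: "\<And>x. strongly_convex \<alpha> (\<lambda>y. - \<Phi> x y)"
    and \<gamma>: "\<gamma> > 0"
  shows "\<exists>w. w \<in> resolvent (scale_op \<gamma> (saddle_operator X Y \<Phi>)) z"
proof -
  obtain x0 y0 where [simp]: "z = (x0, y0)" by force
  \<comment> \<open>The gradient of the penalty is then \<open>(x - x0) / \<gamma>\<close>, so that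
    optimality in \<open>x\<close> reads \<open>x0 = x + \<gamma> *\<^sub>R a\<close> with
    \<open>a\<close> in the first factor of the operator.\<close>
  let ?c = "1 / \<gamma> / 2"
  let ?\<Psi> = "\<lambda>x y. \<Phi> x y + ?c * (norm (x - x0))\<^sup>2 - ?c * (norm (y - y0))\<^sup>2"
  \<comment> \<open>In either variable the penalty on the other one is a constant.\<close>
  have shift: "strongly_convex \<alpha> (\<lambda>x. f x + d)" if "strongly_convex \<alpha> f" for f d
    using convex_on_add[OF that[unfolded strongly_convex_def], of "\<lambda>_. d"]
    by (simp add: strongly_convex_def convex_on_const algebra_simps)
  have c: "?c \<ge> 0" using \<gamma> by simp
  have sx: "strongly_convex \<alpha> (\<lambda>x. ?\<Psi> x y)" for y
    using shift[OF strongly_convex_add_sq_dist[OF cx c], of y x0 "- (?c * (norm (y - y0))\<^sup>2)"]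
    by (simp add: algebra_simps)
  have sy: "strongly_convex \<alpha> (\<lambda>y. - ?\<Psi> x y)" for x
    using shift[OF strongly_convex_add_sq_dist[OF cy c], of x y0 "- (?c * (norm (x - x0))\<^sup>2)"]
    by (simp add: algebra_simps)
  have "continuous_on UNIV (\<lambda>(x, y). ?\<Psi> x y)"
    using cont unfolding case_prod_beta by (intro continuous_intros)
  then obtain w where w: "is_saddle_point X Y ?\<Psi> w"
    using saddle_point_exists[OF X Y \<alpha> _ sx sy] by blast
  then have "0 \<in> saddle_operator X Y ?\<Psi> w"
    using zero_in_saddle_operator_iff[OF X(3) Y(3), of ?\<Psi> w]
      strongly_convex_imp_convex[OF sx] strongly_convex_imp_convex[OF sy] \<alpha> by simp
  moreover obtain x y where [simp]: "w = (x, y)" by force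
  ultimately obtain g n h k where gn: "0 = g + n" "0 = h + k"
    "g \<in> subdiff (\<lambda>x. ?\<Psi> x y) x" "n \<in> normal_cone X x"
    "h \<in> subdiff (\<lambda>y. - ?\<Psi> x y) y" "k \<in> normal_cone Y y"
    by (auto simp: saddle_operator_def set_plus_sets_def zero_prod_def)
  have "g \<in> subdiff (\<lambda>x. \<Phi> x y + ?c * (norm (x - x0))\<^sup>2) x"
    using gn(3) by (simp add: subdiff_def algebra_simps)
  then have g: "g - (1 / \<gamma>) *\<^sub>R (x - x0) \<in> subdiff (\<lambda>x. \<Phi> x y) x"
    using \<alpha> by (intro subdiff_add_sq_distD strongly_convex_imp_convex[OF cx]) auto
  have "h \<in> subdiff (\<lambda>y. - \<Phi> x y + ?c * (norm (y - y0))\<^sup>2) y"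
    using gn(5) by (simp add: subdiff_def algebra_simps)
  then have h: "h - (1 / \<gamma>) *\<^sub>R (y - y0) \<in> subdiff (\<lambda>y. - \<Phi> x y) y"
    using \<alpha> by (intro subdiff_add_sq_distD strongly_convex_imp_convex[OF cy]) auto
  let ?a = "((g - (1 / \<gamma>) *\<^sub>R (x - x0)) + n, (h - (1 / \<gamma>) *\<^sub>R (y - y0)) + k)"
  have "?a \<in> saddle_operator X Y \<Phi> w"
    unfolding saddle_operator_def set_plus_sets_def using g h gn(4,6) by auto
  moreover have "z = w + \<gamma> *\<^sub>R ?a"
  proof -
    have "g = - n" "h = - k" using gn(1,2) by (simp_all add: eq_neg_iff_add_eq_0)
    then show ?thesis using \<gamma> by simp
  qed
  ultimately show ?thesis unfolding resolvent_def scale_op_def by blast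
qed

text \<open>Pair the difference of the two resolvent equations with \<open>w - w'\<close> and divide
  by its norm. The case \<open>z = z'\<close> gives uniqueness of the resolvent value, the general
  case the contraction factor.\<close>

lemma saddle_resolvent_strongly_monotone:
  assumes cx: "\<And>y. strongly_convex \<alpha> (\<lambda>x. \<Phi> x y)" and cy: "\<And>x. strongly_convex \<alpha> (\<lambda>y. - \<Phi> x y)"
    and \<gamma>: "\<gamma> > 0"
    and w: "w \<in> resolvent (scale_op \<gamma> (saddle_operator X Y \<Phi>)) z"
    and w': "w' \<in> resolvent (scale_op \<gamma> (saddle_operator X Y \<Phi>)) z'"
  shows "(1 + \<gamma> * \<alpha>) * norm (w - w') \<le> norm (z - z')"
proof -
  obtain a a' where a: "z = w + \<gamma> *\<^sub>R a" "a \<in> saddle_operator X Y \<Phi> w"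
    and a': "z' = w' + \<gamma> *\<^sub>R a'" "a' \<in> saddle_operator X Y \<Phi> w'"
    using w w' unfolding resolvent_def scale_op_def by blast
  have "z - z' = (w - w') + \<gamma> *\<^sub>R (a - a')" by (simp add: a a' algebra_simps)
  then have "inner (z - z') (w - w') = (norm (w - w'))\<^sup>2 + \<gamma> * inner (a - a') (w - w')"
    by (simp only: inner_add_left inner_scaleR_left power2_norm_eq_inner)
  moreover have "\<gamma> * (\<alpha> * (norm (w - w'))\<^sup>2) \<le> \<gamma> * inner (a - a') (w - w')"
    using saddle_operator_strongly_monotone[OF cx cy a(2) a'(2)] \<gamma> by (intro mult_left_mono) auto
  moreover have "inner (z - z') (w - w') \<le> norm (z - z') * norm (w - w')"
    by (rule norm_cauchy_schwarz)
  ultimately have "((1 + \<gamma> * \<alpha>) * norm (w - w')) * norm (w - w') \<le> norm (z - z') * norm (w - w')"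
    by (simp add: algebra_simps power2_eq_square)
  then show ?thesis by (cases "w = w'") (auto simp: mult_le_cancel_right)
qed

section \<open>Lipschitz curves with an almost everywhere derivative\<close>

lemma locally_lipschitz_imp_lipschitz_on_compact:
  assumes F: "locally_lipschitz_on D F" and K: "compact K" "K \<subseteq> D"
  obtains L where "L-lipschitz_on K F"
proof -
  \<comment> \<open>The map is viewed as a family over the one-point time set \<open>{0}\<close>,
    for which compactness yields a uniform constant.\<close>
  have "local_lipschitz {0::real} K (\<lambda>_. F)"
    unfolding local_lipschitz_def
  proof (intro ballI)
    fix x and t :: real assume "x \<in> K"
    then obtain e L where e: "e > 0" "L-lipschitz_on (ball x e \<inter> D) F"
      using F K unfolding locally_lipschitz_on_def by blast
    have "cball x (e / 2) \<inter> K \<subseteq> ball x e \<inter> D" using K e by auto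
    then show "\<exists>u>0. \<exists>L. \<forall>t\<in>cball t u \<inter> {0::real}. L-lipschitz_on (cball x u \<inter> K) F"
      using e lipschitz_on_subset by (metis half_gt_zero)
  qed
  from local_lipschitz_compact_implies_lipschitz[OF this K(1)] show thesis
    using that by (metis compact_sing continuous_on_const singletonI)
qed

lemma abs_continuous_on_imp_continuous_on:
  fixes c :: "real \<Rightarrow> 'a::real_normed_vector"
  assumes "abs_continuous_on {l..r} c"
  shows "continuous_on {l..r} c"
  unfolding continuous_on_iff
proof (intro ballI allI impI)
  fix x and e :: real assume x: "x \<in> {l..r}" and "e > 0"
  then obtain \<delta> where \<delta>: "\<delta> > 0" and ac: "\<And>(n::nat) (a::nat \<Rightarrow> real) b.
       (\<forall>i<n. a i \<le> b i \<and> {a i..b i} \<subseteq> {l..r}) \<and>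
       (\<forall>i<n. \<forall>j<n. i \<noteq> j \<longrightarrow> {a i<..<b i} \<inter> {a j<..<b j} = {}) \<and>
       (\<Sum>i<n. b i - a i) < \<delta> \<Longrightarrow> (\<Sum>i<n. norm (c (b i) - c (a i))) < e"
    using assms unfolding abs_continuous_on_def by blast
  have "dist (c y) (c x) < e" if "y \<in> {l..r}" "dist y x < \<delta>" for y
    using ac[of 1 "\<lambda>_. min x y" "\<lambda>_. max x y"] x that
    by (cases "x \<le> y") (auto simp: dist_norm norm_minus_commute)
  then show "\<exists>d>0. \<forall>y\<in>{l..r}. dist y x < d \<longrightarrow> dist (c y) (c x) < e" using \<delta> by blast
qed

lemma abs_continuous_on_lipschitz_compose:
  assumes c: "abs_continuous_on S c" and f: "L-lipschitz_on (c ` S) f"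
  shows "abs_continuous_on S (\<lambda>t. f (c t))"
  unfolding abs_continuous_on_def
proof (intro allI impI)
  fix e :: real assume "e > 0"
  have L: "L \<ge> 0" using f by (rule lipschitz_on_nonneg)
  \<comment> \<open>\<open>L + 1\<close> covers the case \<open>L = 0\<close>.\<close>
  then have "e / (L + 1) > 0" using \<open>e > 0\<close> by simp
  then obtain \<delta> where \<delta>: "\<delta> > 0" and ac: "\<And>(n::nat) (a::nat \<Rightarrow> real) b.
       (\<forall>i<n. a i \<le> b i \<and> {a i..b i} \<subseteq> S) \<and>
       (\<forall>i<n. \<forall>j<n. i \<noteq> j \<longrightarrow> {a i<..<b i} \<inter> {a j<..<b j} = {}) \<and>
       (\<Sum>i<n. b i - a i) < \<delta> \<Longrightarrow> (\<Sum>i<n. norm (c (b i) - c (a i))) < e / (L + 1)"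
    using c unfolding abs_continuous_on_def by blast
  have "(\<Sum>i<n. norm (f (c (b i)) - f (c (a i)))) < e"
    if *: "(\<forall>i<n. a i \<le> b i \<and> {a i..b i} \<subseteq> S) \<and>
       (\<forall>i<n. \<forall>j<n. i \<noteq> j \<longrightarrow> {a i<..<b i} \<inter> {a j<..<b j} = {}) \<and>
       (\<Sum>i<n. b i - a i) < \<delta>" for n :: nat and a b :: "nat \<Rightarrow> real"
  proof -
    have "norm (f (c (b i)) - f (c (a i))) \<le> (L + 1) * norm (c (b i) - c (a i))" if "i < n" for i
    proof -
      have "a i \<in> {a i..b i}" "b i \<in> {a i..b i}" using * that by auto
      then have "a i \<in> S" "b i \<in> S" using * that by blast+
      then have "norm (f (c (b i)) - f (c (a i))) \<le> L * norm (c (b i) - c (a i))"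
        using lipschitz_onD[OF f, of "c (b i)" "c (a i)"] by (auto simp: dist_norm)
      also have "\<dots> \<le> (L + 1) * norm (c (b i) - c (a i))" by (intro mult_right_mono) auto
      finally show ?thesis .
    qed
    then have "(\<Sum>i<n. norm (f (c (b i)) - f (c (a i)))) \<le> (\<Sum>i<n. (L + 1) * norm (c (b i) - c (a i)))"
      by (intro sum_mono) auto
    also have "\<dots> = (L + 1) * (\<Sum>i<n. norm (c (b i) - c (a i)))" by (simp add: sum_distrib_left)
    also have "\<dots> < (L + 1) * (e / (L + 1))"
      using ac[OF *] L by (intro mult_strict_left_mono) auto
    finally show ?thesis using L by simp
  qed
  then show "\<exists>\<delta>>0. \<forall>(n::nat) (a::nat \<Rightarrow> real) b. (\<forall>i<n. a i \<le> b i \<and> {a i..b i} \<subseteq> S) \<and>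
       (\<forall>i<n. \<forall>j<n. i \<noteq> j \<longrightarrow> {a i<..<b i} \<inter> {a j<..<b j} = {}) \<and>
       (\<Sum>i<n. b i - a i) < \<delta> \<longrightarrow> (\<Sum>i<n. norm (f (c (b i)) - f (c (a i)))) < e"
    using \<delta> by blast
qed

lemma lipschitz_on_affine_curve: "(norm v)-lipschitz_on S (\<lambda>t. w + t *\<^sub>R v)"
  by (rule lipschitz_onI) (auto simp: dist_norm norm_scaleR simp flip: scaleR_diff_left)

lemma abs_continuous_on_affine_curve:
  "abs_continuous_on S (\<lambda>t. w + t *\<^sub>R v)"
proof -
  have "abs_continuous_on S (\<lambda>t. t)"
    unfolding abs_continuous_on_def
  proof (intro allI impI)
    fix e :: real assume "e > 0"
    moreover have "(\<Sum>i<n. norm (b i - a i)) = (\<Sum>i<n. b i - a i)"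
      if "\<forall>i<n. a i \<le> b i" for n and a b :: "nat \<Rightarrow> real"
      using that by (intro sum.cong) auto
    ultimately show "\<exists>\<delta>>0. \<forall>(n::nat) (a::nat \<Rightarrow> real) b. (\<forall>i<n. a i \<le> b i \<and> {a i..b i} \<subseteq> S) \<and>
       (\<forall>i<n. \<forall>j<n. i \<noteq> j \<longrightarrow> {a i<..<b i} \<inter> {a j<..<b j} = {}) \<and>
       (\<Sum>i<n. b i - a i) < \<delta> \<longrightarrow> (\<Sum>i<n. norm (b i - a i)) < e"
      by metis
  qed
  then show ?thesis
    by (rule abs_continuous_on_lipschitz_compose[where L = "norm v"])
      (rule lipschitz_on_affine_curve)
qed

text \<open>Almost every level \<open>y\<close> between \<open>h a\<close> and \<open>h b\<close> is not attained on the exceptional set,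
  since Lipschitz images of null sets are null; at the last passage through such a level
  the derivative cannot be negative.\<close>

lemma lipschitz_AE_negative_deriv_imp_le:
  fixes h :: "real \<Rightarrow> real"
  assumes ab: "a \<le> b" and h: "L-lipschitz_on {a..b} h" and N: "negligible N"
    and deriv: "\<And>t. a < t \<Longrightarrow> t < b \<Longrightarrow> t \<notin> N \<Longrightarrow> \<exists>d<0. (h has_real_derivative d) (at t)"
  shows "h b \<le> h a"
proof (rule ccontr)
  assume "\<not> h b \<le> h a"
  then have lt: "h a < h b" by simp
  \<comment> \<open>Adding the endpoints ensures that the last passage is not one of them.\<close>
  let ?N = "(N \<inter> {a..b}) \<union> {a, b}"
  have "negligible (h ` ?N)"
  proof (rule negligible_locally_Lipschitz_image)
    show "negligible ?N" using N by (auto intro: negligible_Int)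
    fix x assume "x \<in> ?N"
    moreover have "?N \<subseteq> {a..b}" using ab by auto
    ultimately have "\<forall>y \<in> ?N \<inter> UNIV. norm (h y - h x) \<le> L * norm (y - x)"
      using lipschitz_onD[OF h] unfolding dist_norm by blast
    then show "\<exists>T B. open T \<and> x \<in> T \<and> (\<forall>y \<in> ?N \<inter> T. norm (h y - h x) \<le> B * norm (y - x))"
      by blast
  qed simp
  moreover have "\<not> negligible {h a<..<h b}"
    using lt negligible_interval(2)[of "h a" "h b"] by (simp add: box_real)
  ultimately obtain y where y: "h a < y" "y < h b" "y \<notin> h ` ?N"
    by (meson greaterThanLessThan_iff negligible_subset subsetI)
  have cont: "continuous_on {a..b} h" by (rule lipschitz_on_continuous_on[OF h])
  let ?S = "{t \<in> {a..b}. h t \<le> y}"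
  have "closed ({a..b} \<inter> h -` {..y})"
    by (intro continuous_closed_preimage[OF cont]) auto
  then have "compact ({a..b} \<inter> ({a..b} \<inter> h -` {..y}))" by (intro compact_Int_closed) auto
  moreover have "{a..b} \<inter> ({a..b} \<inter> h -` {..y}) = ?S" by auto
  ultimately have "compact ?S" by simp
  moreover have "a \<in> ?S" using ab y by simp
  ultimately obtain t where t: "t \<in> ?S" "\<And>s. s \<in> ?S \<Longrightarrow> s \<le> t"
    using compact_attains_sup[of ?S] by blast
  have tb: "t < b" using t y by (metis (mono_tags, lifting) atLeastAtMost_iff le_less linorder_not_le mem_Collect_eq)
  have "h t = y"
  proof (rule ccontr)
    assume "h t \<noteq> y"
    then have "h t < y" using t by simp
    moreover have "continuous_on {t..b} h"
      using t by (intro continuous_on_subset[OF cont]) auto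
    ultimately obtain s where s: "t \<le> s" "s \<le> b" "h s = y"
      using IVT'[of h t y b] tb y by (auto simp: less_imp_le)
    then have "s \<le> t" using t by auto
    then show False using s \<open>h t \<noteq> y\<close> by auto
  qed
  then have "t \<notin> ?N" using y by blast
  then have "a < t" "t \<notin> N" using t by auto
  then obtain d where d: "d < 0" "(h has_real_derivative d) (at t)" using deriv tb by blast
  obtain e where e: "e > 0" "\<And>u. 0 < u \<Longrightarrow> u < e \<Longrightarrow> h (t + u) < h t"
    using DERIV_neg_dec_right[OF d(2,1)] by blast
  define u where "u = min (e / 2) (b - t)"
  have u: "0 < u" "u < e" "t + u \<le> b" using e(1) tb by (auto simp: u_def)
  then have "t + u \<in> ?S" using t(1) e(2)[of u] \<open>h t = y\<close> by auto
  then have "t + u \<le> t" using t(2) by blast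
  then show False using u by simp
qed

text \<open>Pairing with the defect \<open>e = \<phi> 1 - \<phi> 0 - d\<close> reduces to a scalar
  function. Subtracting a slope \<open>k\<close> just above the bound on its derivative makes it
  decrease, so the squared norm of \<open>e\<close> is at most
  \<open>\<epsilon> * norm e + \<eta>\<close>.\<close>

lemma lipschitz_AE_mean_value_bound:
  fixes \<phi> :: "real \<Rightarrow> 'a::real_inner"
  assumes \<phi>: "L-lipschitz_on {0..1} \<phi>"
    and AE: "AE t in lborel. t \<in> {0..1} \<longrightarrow>
      (\<exists>d'. (\<phi> has_vector_derivative d') (at t) \<and> norm (d' - d) \<le> \<epsilon>)"
  shows "norm (\<phi> 1 - \<phi> 0 - d) \<le> \<epsilon>"
proof -
  obtain N where N: "N \<in> null_sets lborel" "{t. \<not> (t \<in> {0..1} \<longrightarrow>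
      (\<exists>d'. (\<phi> has_vector_derivative d') (at t) \<and> norm (d' - d) \<le> \<epsilon>))} \<subseteq> N"
    using AE by (auto elim!: AE_E simp: null_sets_def)
  have negl: "negligible N"
    using N(1) by (simp add: negligible_iff_null_sets null_sets_completionI)
  have ex: "\<exists>d'. (\<phi> has_vector_derivative d') (at t) \<and> norm (d' - d) \<le> \<epsilon>"
    if "0 < t" "t < 1" "t \<notin> N" for t
  proof (rule ccontr)
    assume "\<not> ?thesis"
    then have "t \<in> N" using that by (intro subsetD[OF N(2)]) auto
    then show False using that by simp
  qed
  define e where "e = \<phi> 1 - \<phi> 0 - d"
  have "(norm e)\<^sup>2 \<le> \<epsilon> * norm e + \<eta>" if \<eta>: "\<eta> > 0" for \<eta>
  proof -
    \<comment> \<open>The slack \<open>\<eta>\<close> makes the derivative of \<open>h\<close>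
      strictly negative.\<close>
    define k where "k = inner d e + \<epsilon> * norm e + \<eta>"
    define h where "h t = inner (\<phi> t) e - t * k" for t
    have "h 1 \<le> h 0"
    proof (rule lipschitz_AE_negative_deriv_imp_le[where h = h and a = 0 and b = 1, OF _ _ negl])
      show "(L * norm e + \<bar>k\<bar>)-lipschitz_on {0..1} h"
      proof (rule lipschitz_onI)
        fix s t :: real assume st: "s \<in> {0..1}" "t \<in> {0..1}"
        have "\<bar>inner (\<phi> s - \<phi> t) e\<bar> \<le> norm (\<phi> s - \<phi> t) * norm e" by (rule Cauchy_Schwarz_ineq2)
        also have "\<dots> \<le> (L * \<bar>s - t\<bar>) * norm e"
          using lipschitz_onD[OF \<phi> st] by (intro mult_right_mono) (auto simp: dist_norm dist_real_def)
        finally have "\<bar>inner (\<phi> s - \<phi> t) e\<bar> + \<bar>(s - t) * k\<bar> \<le> (L * norm e + \<bar>k\<bar>) * \<bar>s - t\<bar>"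
          unfolding abs_mult by (simp add: algebra_simps)
        moreover have "h s - h t = inner (\<phi> s - \<phi> t) e - (s - t) * k"
          by (simp add: h_def algebra_simps)
        ultimately show "dist (h s) (h t) \<le> (L * norm e + \<bar>k\<bar>) * dist s t"
          unfolding dist_real_def by linarith
      qed (use lipschitz_on_nonneg[OF \<phi>] in auto)
      fix t :: real assume "0 < t" "t < 1" "t \<notin> N"
      then obtain d' where d': "(\<phi> has_vector_derivative d') (at t)" "norm (d' - d) \<le> \<epsilon>"
        using ex by blast
      have "((\<lambda>t. inner (\<phi> t) e) has_vector_derivative inner d' e) (at t)"
        using bounded_linear.has_vector_derivative[OF bounded_linear_inner_left d'(1)] .
      then have "(h has_real_derivative (inner d' e - k)) (at t)"
        unfolding h_def has_real_derivative_iff_has_vector_derivative[symmetric]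
        by (auto intro!: derivative_eq_intros)
      moreover have "inner (d' - d) e \<le> \<epsilon> * norm e"
        using norm_cauchy_schwarz[of "d' - d" e] mult_right_mono[OF d'(2), of "norm e"] by simp
      then have "inner d' e - k < 0" using \<eta> by (simp add: k_def inner_diff_left)
      ultimately show "\<exists>d<0. (h has_real_derivative d) (at t)" by blast
    qed simp
    moreover have "(norm e)\<^sup>2 = inner (\<phi> 1) e - inner (\<phi> 0) e - inner d e"
      unfolding power2_norm_eq_inner by (subst (1) e_def) (simp add: inner_diff_left)
    ultimately show ?thesis by (simp add: h_def k_def)
  qed
  then have "(norm e)\<^sup>2 \<le> \<epsilon> * norm e" by (rule field_le_epsilon)
  \<comment> \<open>This settles the case \<open>e = 0\<close>: outside the null set there is a
    point of the interval, and there \<open>\<epsilon>\<close> bounds a norm.\<close>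
  moreover have "\<epsilon> \<ge> 0"
  proof -
    have "\<not> negligible {0<..<1::real}" using negligible_interval(2)[of 0 "1::real"] by simp
    then obtain t where "0 < t" "t < 1" "t \<notin> N"
      using negl by (meson greaterThanLessThan_iff negligible_subset subsetI)
    then show ?thesis using ex norm_ge_zero order_trans by blast
  qed
  ultimately show ?thesis
    unfolding e_def[symmetric] by (cases "norm e = 0") (auto simp: power2_eq_square)
qed

section \<open>Conservative Jacobians\<close>

lemma LIMSEQ_shrinking_balls:
  fixes e :: real
  assumes "\<And>k. s k \<in> ball z (e / Suc k)"
  shows "s \<longlonglongrightarrow> z"
  unfolding tendsto_dist_iff[of s]
proof (rule tendsto_sandwich[where f = "\<lambda>_. 0"])
  show "(\<lambda>k. e / real (Suc k)) \<longlonglongrightarrow> 0"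
    by (rule LIMSEQ_Suc[OF lim_const_over_n])
  show "eventually (\<lambda>k. dist (s k) z \<le> e / real (Suc k)) sequentially"
    using assms by (intro always_eventually allI) (auto simp: dist_commute less_imp_le)
qed auto

text \<open>The local bound makes a tail of \<open>M\<close> bounded, hence subconvergent, and the
  closed graph places the limit in \<open>J z\<close>.\<close>

lemma closed_graph_subseq:
  fixes J :: "'a::metric_space \<Rightarrow> 'b::{real_normed_vector,heine_borel} set"
  assumes bdd: "\<exists>e>0. \<exists>B. \<forall>w\<in>ball z e \<inter> D. \<forall>M\<in>J w. norm M \<le> B"
    and cl: "closedin (top_of_set (D \<times> UNIV)) {(z, M). z \<in> D \<and> M \<in> J z}"
    and z: "z \<in> D" and s: "\<And>k. s k \<in> D" "s \<longlonglongrightarrow> z" and M: "\<And>k. M k \<in> J (s k)"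
  obtains N r where "N \<in> J z" "strict_mono (r :: nat \<Rightarrow> nat)" "(M \<circ> r) \<longlonglongrightarrow> N"
proof -
  obtain e B where e: "e > 0" and B: "\<And>w M. w \<in> ball z e \<inter> D \<Longrightarrow> M \<in> J w \<Longrightarrow> norm M \<le> B"
    using bdd by blast
  have "eventually (\<lambda>k. s k \<in> ball z e) sequentially"
    using s(2) e by (simp add: tendsto_iff dist_commute)
  then obtain K where K: "\<And>k. k \<ge> K \<Longrightarrow> s k \<in> ball z e"
    by (auto simp: eventually_sequentially)
  have "bounded (range (\<lambda>k. M (k + K)))"
    using B[OF _ M] K s(1) by (auto simp: bounded_iff intro!: exI[of _ B])
  then obtain N r where r: "strict_mono r" "((\<lambda>k. M (k + K)) \<circ> r) \<longlonglongrightarrow> N"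
    using bounded_imp_convergent_subsequence by blast
  define q where "q k = r k + K" for k
  have q: "strict_mono q" using r(1) by (simp add: strict_mono_def q_def)
  have Mq: "(M \<circ> q) \<longlonglongrightarrow> N" using r(2) by (simp add: comp_def q_def)
  obtain C where C: "closed C" "{(z, M). z \<in> D \<and> M \<in> J z} = (D \<times> UNIV) \<inter> C"
    using cl by (auto simp: closedin_closed)
  have "(s (q k), M (q k)) \<in> C" for k using C(2) s(1) M by blast
  moreover have "(\<lambda>k. (s (q k), M (q k))) \<longlonglongrightarrow> (z, N)"
    using LIMSEQ_subseq_LIMSEQ[OF s(2) q] Mq by (intro tendsto_Pair) (simp_all add: comp_def)
  ultimately have "(z, N) \<in> C"
    using closed_sequentially[OF C(1), of "\<lambda>k. (s (q k), M (q k))"] by blast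
  then have "N \<in> J z" using C(2) z by blast
  then show thesis using that q Mq by blast
qed

lemma closed_graphI:
  fixes J :: "'a::metric_space \<Rightarrow> 'b::metric_space set"
  assumes "\<And>s M z N. (\<And>k. s k \<in> D) \<Longrightarrow> s \<longlonglongrightarrow> z \<Longrightarrow> z \<in> D \<Longrightarrow> (\<And>k. M k \<in> J (s k)) \<Longrightarrow>
    M \<longlonglongrightarrow> N \<Longrightarrow> N \<in> J z"
  shows "closedin (top_of_set (D \<times> UNIV)) {(z, M). z \<in> D \<and> M \<in> J z}"
proof -
  let ?G = "{(z, M). z \<in> D \<and> M \<in> J z}"
  have "(z, N) \<in> ?G" if "z \<in> D" "(z, N) \<in> closure ?G" for z N
  proof -
    obtain x where x: "\<And>k. x k \<in> ?G" "x \<longlonglongrightarrow> (z, N)" using \<open>(z, N) \<in> closure ?G\<close> unfolding closure_sequential by blast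
    then have "fst (x k) \<in> D" "snd (x k) \<in> J (fst (x k))" for k
      by (auto simp: case_prod_beta)
    then have "N \<in> J z"
      using assms[of "\<lambda>k. fst (x k)" z "\<lambda>k. snd (x k)" N] tendsto_fst[OF x(2)] tendsto_snd[OF x(2)] that(1)
      by simp
    then show ?thesis using that(1) by simp
  qed
  then have "?G = (D \<times> UNIV) \<inter> closure ?G" using closure_subset[of ?G] by auto
  then show ?thesis unfolding closedin_closed using closed_closure by blast
qed

text \<open>Values outside \<open>U\<close> over points tending to \<open>z\<close> would
  subconverge to an element of \<open>J z\<close> in the closed complement of
  \<open>U\<close>.\<close>

lemma closed_graph_upper_semicontinuous:
  fixes J :: "'a::metric_space \<Rightarrow> 'b::{real_normed_vector,heine_borel} set"
  assumes bdd: "\<exists>e>0. \<exists>B. \<forall>w\<in>ball z e \<inter> D. \<forall>M\<in>J w. norm M \<le> B"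
    and cl: "closedin (top_of_set (D \<times> UNIV)) {(z, M). z \<in> D \<and> M \<in> J z}"
    and z: "z \<in> D" and U: "open U" "J z \<subseteq> U"
  obtains \<delta> where "\<delta> > 0" "\<And>u. u \<in> ball z \<delta> \<inter> D \<Longrightarrow> J u \<subseteq> U"
proof (rule ccontr)
  assume no: "\<not> thesis"
  have "\<exists>u M. u \<in> ball z (1 / Suc k) \<inter> D \<and> M \<in> J u \<and> M \<notin> U" for k :: nat
    using no that[of "1 / Suc k"] by fastforce
  then obtain s M where sM: "\<And>k. s k \<in> ball z (1 / Suc k) \<inter> D" "\<And>k. M k \<in> J (s k)" "\<And>k. M k \<notin> U"
    by metis
  have "s \<longlonglongrightarrow> z" by (rule LIMSEQ_shrinking_balls) (use sM(1) in blast)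
  then obtain N r where N: "N \<in> J z" "strict_mono r" "(M \<circ> r) \<longlonglongrightarrow> N"
    using closed_graph_subseq[OF bdd cl z, of s M] sM by blast
  have "N \<in> - U"
    using closed_sequentially[of "- U" "M \<circ> r" N] U(1) N(3) sM(3) by (simp add: closed_def)
  then show False using N(1) U(2) by blast
qed

section \<open>Consequences of the chain rule along segments\<close>

lemma conservative_jacobian_onD:
  assumes "conservative_jacobian_on D F J"
  shows conservative_jacobian_nonempty: "z \<in> D \<Longrightarrow> J z \<noteq> {}"
    and conservative_jacobian_bounded: "z \<in> D \<Longrightarrow> \<exists>e>0. \<exists>B. \<forall>w\<in>ball z e \<inter> D. \<forall>M\<in>J w. norm M \<le> B"
    and conservative_jacobian_closed_graph: "closedin (top_of_set (D \<times> UNIV)) {(z, M). z \<in> D \<and> M \<in> J z}"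
    and conservative_jacobian_chain: "abs_continuous_on {0..1} c \<Longrightarrow> c ` {0..1} \<subseteq> D \<Longrightarrow>
        AE t in lborel. t \<in> {0..1} \<longrightarrow>
           (\<exists>c' d. (c has_vector_derivative c') (at t) \<and>
                   ((F \<circ> c) has_vector_derivative d) (at t) \<and>
                   (\<forall>M\<in>J (c t). d = blinfun_apply M c'))"
  using assms unfolding conservative_jacobian_on_def by blast+

lemma conservative_jacobian_segment:
  assumes J: "conservative_jacobian_on D F J"
    and seg: "\<And>t. t \<in> {0..1} \<Longrightarrow> w + t *\<^sub>R v \<in> D"
  shows "AE t in lborel. t \<in> {0..1} \<longrightarrow>
      (\<exists>d. ((\<lambda>t. F (w + t *\<^sub>R v)) has_vector_derivative d) (at t) \<and>
        (\<forall>M\<in>J (w + t *\<^sub>R v). d = blinfun_apply M v))"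
proof -
  let ?c = "\<lambda>t. w + t *\<^sub>R v"
  have "AE t in lborel. t \<in> {0..1} \<longrightarrow>
           (\<exists>c' d. (?c has_vector_derivative c') (at t) \<and>
                   ((F \<circ> ?c) has_vector_derivative d) (at t) \<and>
                   (\<forall>M\<in>J (?c t). d = blinfun_apply M c'))"
    by (rule conservative_jacobian_chain[OF J abs_continuous_on_affine_curve]) (use seg in auto)
  \<comment> \<open>The chain rule supplies some velocity; on an affine curve it can only be
    \<open>v\<close>.\<close>
  moreover have "c' = v" if "(?c has_vector_derivative c') (at t)" for c' t
  proof (rule vector_derivative_unique_at[OF that])
    show "(?c has_vector_derivative v) (at t)" by (auto intro!: derivative_eq_intros)
  qed
  ultimately show ?thesis by (auto elim!: eventually_mono simp: comp_def) 
qed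

text \<open>Almost everywhere on the segment the derivative of \<open>F\<close> is the value at
  \<open>v\<close> of any element of \<open>J\<close>. This converts closeness of the values of
  \<open>J\<close> near a point into differentiability.\<close>

lemma conservative_jacobian_increment:
  fixes F :: "'a::euclidean_space \<Rightarrow> 'b::euclidean_space"
  assumes J: "conservative_jacobian_on D F J" and F: "locally_lipschitz_on D F"
    and seg: "closed_segment w (w + v) \<subseteq> D"
    and bound: "\<And>u M. u \<in> closed_segment w (w + v) \<Longrightarrow> M \<in> J u \<Longrightarrow> norm (blinfun_apply M v - d) \<le> \<epsilon>"
  shows "norm (F (w + v) - F w - d) \<le> \<epsilon>"
proof -
  let ?c = "\<lambda>t. w + t *\<^sub>R v"
  have c: "?c t \<in> closed_segment w (w + v)" if "t \<in> {0..1}" for t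
    using that by (auto simp: in_segment algebra_simps intro!: exI[of _ t])
  obtain L where L: "L-lipschitz_on (closed_segment w (w + v)) F"
    using locally_lipschitz_imp_lipschitz_on_compact[OF F compact_segment seg] .
  then have "L-lipschitz_on (?c ` {0..1}) F" by (rule lipschitz_on_subset) (use c in auto)
  from lipschitz_on_compose[OF lipschitz_on_affine_curve[of v "{0..1}" w] this]
  have lip: "(L * norm v)-lipschitz_on {0..1} (\<lambda>t. F (?c t))" by (simp add: comp_def)
  have "AE t in lborel. t \<in> {0..1} \<longrightarrow>
      (\<exists>d'. ((\<lambda>t. F (?c t)) has_vector_derivative d') (at t) \<and> norm (d' - d) \<le> \<epsilon>)"
  proof (rule eventually_mono[OF conservative_jacobian_segment[OF J, of w v]])
    show "?c t \<in> D" if "t \<in> {0..1}" for t using c[OF that] seg by blast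
    fix t
    assume *: "t \<in> {0..1} \<longrightarrow> (\<exists>d. ((\<lambda>t. F (?c t)) has_vector_derivative d) (at t) \<and>
        (\<forall>M\<in>J (?c t). d = blinfun_apply M v))"
    show "t \<in> {0..1} \<longrightarrow>
      (\<exists>d'. ((\<lambda>t. F (?c t)) has_vector_derivative d') (at t) \<and> norm (d' - d) \<le> \<epsilon>)"
    proof
      assume t: "t \<in> {0..1}"
      then obtain d' where d': "((\<lambda>t. F (?c t)) has_vector_derivative d') (at t)"
        "\<forall>M\<in>J (?c t). d' = blinfun_apply M v" using * by blast
      obtain M where M: "M \<in> J (?c t)"
        using conservative_jacobian_nonempty[OF J] c[OF t] seg by blast
      then show "\<exists>d'. ((\<lambda>t. F (?c t)) has_vector_derivative d') (at t) \<and> norm (d' - d) \<le> \<epsilon>"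
        using d' bound[OF c[OF t] M] by auto
    qed
  qed
  from lipschitz_AE_mean_value_bound[OF lip this] show ?thesis by simp
qed

text \<open>Upper semicontinuity keeps \<open>J\<close> within \<open>e\<close> of \<open>M\<close>
  near \<open>s\<close>, and the increment estimate turns this into Frechet
  differentiability.\<close>

lemma conservative_jacobian_singleton_imp_has_derivative:
  fixes F :: "'a::euclidean_space \<Rightarrow> 'b::euclidean_space"
  assumes J: "conservative_jacobian_on D F J" and F: "locally_lipschitz_on D F"
    and D: "open D" "s \<in> D" and M: "J s = {M}"
  shows "(F has_derivative blinfun_apply M) (at s)"
  unfolding has_derivative_at_alt
proof (intro conjI allI impI)
  show "bounded_linear (blinfun_apply M)" by (rule blinfun.bounded_linear_right)
  fix e :: real assume e: "e > 0"
  obtain \<delta> where \<delta>: "\<delta> > 0" and usc: "\<And>u. u \<in> ball s \<delta> \<inter> D \<Longrightarrow> J u \<subseteq> ball M e"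
    using closed_graph_upper_semicontinuous[OF conservative_jacobian_bounded[OF J D(2)]
      conservative_jacobian_closed_graph[OF J] D(2), of "ball M e"] M e by auto
  obtain r where r: "r > 0" "ball s r \<subseteq> D" using D open_contains_ball by blast
  have "norm (F y - F s - blinfun_apply M (y - s)) \<le> e * norm (y - s)"
    if y: "norm (y - s) < min r \<delta>" for y
  proof -
    have "y \<in> ball s (min r \<delta>)" using y by (simp add: dist_norm norm_minus_commute)
    moreover have "s \<in> ball s (min r \<delta>)" using r \<delta> by simp
    ultimately have "closed_segment s y \<subseteq> ball s (min r \<delta>)"
      using closed_segment_subset convex_ball by blast
    moreover have "ball s (min r \<delta>) \<subseteq> ball s \<delta> \<inter> D" using r by auto
    ultimately have seg: "closed_segment s (s + (y - s)) \<subseteq> ball s \<delta> \<inter> D" by (simp only: add_diff_cancel_left' add_diff_eq)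
    have "norm (F (s + (y - s)) - F s - blinfun_apply M (y - s)) \<le> e * norm (y - s)"
    proof (rule conservative_jacobian_increment[OF J F])
      fix u N assume "u \<in> closed_segment s (s + (y - s))" "N \<in> J u"
      then have "N \<in> ball M e" using seg usc by blast
      then have "norm (N - M) \<le> e" by (simp add: dist_norm norm_minus_commute)
      then show "norm (blinfun_apply N (y - s) - blinfun_apply M (y - s)) \<le> e * norm (y - s)"
        using norm_blinfun[of "N - M" "y - s"]
        by (simp add: blinfun.diff_left) (meson mult_right_mono norm_ge_zero order_trans)
    qed (use seg in auto)
    then show ?thesis by simp
  qed
  then show "\<exists>d>0. \<forall>y. norm (y - s) < d \<longrightarrow> norm (F y - F s - blinfun_apply M (y - s)) \<le> e * norm (y - s)"
    using r \<delta> by (metis min_less_iff_conj)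
qed

text \<open>The set of points where the values in direction \<open>v\<close> of the Jacobian oscillate by less than
  \<open>1 / Suc k\<close> is open, and dense because conservativity makes \<open>J\<close> single-valued in direction \<open>v\<close>
  at almost every point of every segment parallel to \<open>v\<close>. This gives a category
  substitute for Rademacher's theorem.\<close>

lemma conservative_jacobian_singleton_dense:
  fixes F :: "'a::euclidean_space \<Rightarrow> 'b::euclidean_space"
  assumes J: "conservative_jacobian_on D F J" and e: "e > 0" "ball z e \<subseteq> D"
  obtains s M where "s \<in> ball z e" "J s = {M}"
proof -
  define Osc where "Osc v k = {s \<in> D. \<forall>M\<in>J s. \<forall>N\<in>J s. norm (blinfun_apply M v - blinfun_apply N v) < 1 / Suc k}"
    for v and k :: nat
  \<comment> \<open>Baire's theorem is applied in this closed set; the half radius keeps it inside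
    \<open>D\<close> and inside the open ball of the conclusion.\<close>
  let ?S = "cball z (e / 2)"
  have SD: "?S \<subseteq> D" using e by auto
  let ?G = "{Osc v k \<inter> ?S | v k. v \<in> Basis}"
  have ope: "openin (top_of_set ?S) (Osc v k \<inter> ?S)" for v k
  proof -
    \<comment> \<open>Pairs in \<open>J\<close> with a gap of at least \<open>1 / Suc k\<close>
      subconverge to such a pair over the limit point; the second subsequence is extracted from the
      first.\<close>
    have "closed (?S - Osc v k)"
      unfolding closed_sequential_limits
    proof (intro allI impI)
      fix x l assume "(\<forall>n. x n \<in> ?S - Osc v k) \<and> x \<longlonglongrightarrow> l"
      then have x: "\<And>n. x n \<in> ?S" "\<And>n. x n \<notin> Osc v k" "x \<longlonglongrightarrow> l" by auto
      have l: "l \<in> ?S" using closed_sequentially[OF closed_cball x(1) x(3)] by blast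
      have "\<exists>M N. M \<in> J (x n) \<and> N \<in> J (x n) \<and> 1 / Suc k \<le> norm (blinfun_apply M v - blinfun_apply N v)" for n
        using x(1,2)[of n] SD by (auto simp: Osc_def not_less)
      then obtain M N where MN: "\<And>n. M n \<in> J (x n)" "\<And>n. N n \<in> J (x n)"
        "\<And>n. 1 / Suc k \<le> norm (blinfun_apply (M n) v - blinfun_apply (N n) v)"
        by metis
      have lD: "l \<in> D" and xD: "\<And>n. x n \<in> D" using l x(1) SD by auto
      note sub = closed_graph_subseq[OF conservative_jacobian_bounded[OF J lD]
          conservative_jacobian_closed_graph[OF J] lD]
      obtain M' r where M': "M' \<in> J l" "strict_mono r" "(M \<circ> r) \<longlonglongrightarrow> M'"
        using sub[OF xD x(3) MN(1)] by blast
      obtain N' q where N': "N' \<in> J l" "strict_mono q" "((N \<circ> r) \<circ> q) \<longlonglongrightarrow> N'"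
        using sub[of "x \<circ> r" "N \<circ> r"] xD MN(2) LIMSEQ_subseq_LIMSEQ[OF x(3) M'(2)] by auto
      have "(\<lambda>n. norm (blinfun_apply (((M \<circ> r) \<circ> q) n) v - blinfun_apply (((N \<circ> r) \<circ> q) n) v))
          \<longlonglongrightarrow> norm (blinfun_apply M' v - blinfun_apply N' v)"
        by (intro tendsto_intros LIMSEQ_subseq_LIMSEQ[OF M'(3) N'(2)] N'(3))
      then have "1 / Suc k \<le> norm (blinfun_apply M' v - blinfun_apply N' v)"
        by (rule LIMSEQ_le_const) (use MN(3) in auto)
      then show "l \<in> ?S - Osc v k" using l M'(1) N'(1) by (auto simp: Osc_def not_less)
    qed
    then have "openin (top_of_set ?S) (?S - (?S - Osc v k))"
      by (intro openin_diff closed_subset) auto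
    moreover have "?S - (?S - Osc v k) = Osc v k \<inter> ?S" by auto
    ultimately show ?thesis by simp
  qed
  have dense: "?S \<subseteq> closure (Osc v k \<inter> ?S)" if v: "v \<in> Basis" for v k
  proof -
    have "x \<in> closure (Osc v k \<inter> ?S)" if x: "x \<in> ball z (e / 2)" for x
      unfolding closure_approachable
    proof (intro allI impI)
      fix \<rho> :: real assume "\<rho> > 0"
      obtain r where r: "r > 0" "ball x r \<subseteq> ball z (e / 2)" using x open_contains_ball open_ball by blast
      \<comment> \<open>\<open>v\<close> is a unit vector, so a segment of this length from
        \<open>x\<close> stays in both balls about \<open>x\<close>.\<close>
      define h where "h = min r \<rho> / 2"
      have h: "h > 0" "h < r" "h < \<rho>" using r \<open>\<rho> > 0\<close> by (auto simp: h_def)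
      have c: "x + t *\<^sub>R (h *\<^sub>R v) \<in> ball x (min r \<rho>)" if "t \<in> {0..1}" for t
      proof -
        have "t * h \<le> h" using that h by (simp add: mult_left_le_one_le)
        then have "t * h < min r \<rho>" using h by linarith
        then show ?thesis using that h v by (simp add: dist_norm abs_mult)
      qed
      have cD: "x + t *\<^sub>R (h *\<^sub>R v) \<in> ?S" if "t \<in> {0..1}" for t
        using c[OF that] r by (auto simp: subset_iff)
      have "AE t in lborel. t \<in> {0..1} \<longrightarrow>
        (\<exists>d. ((\<lambda>t. F (x + t *\<^sub>R (h *\<^sub>R v))) has_vector_derivative d) (at t) \<and>
        (\<forall>M\<in>J (x + t *\<^sub>R (h *\<^sub>R v)). d = blinfun_apply M (h *\<^sub>R v)))"
        by (rule conservative_jacobian_segment[OF J]) (use cD SD in blast)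
      \<comment> \<open>A property that holds almost everywhere on \<open>{0..1}\<close> holds
        somewhere, since the interval is not null.\<close>
      then obtain t where t: "t \<in> {0..1}" and
        d: "\<exists>d. \<forall>M\<in>J (x + t *\<^sub>R (h *\<^sub>R v)). d = blinfun_apply M (h *\<^sub>R v)"
      proof -
        assume AE: "AE t in lborel. t \<in> {0..1::real} \<longrightarrow> (\<exists>d. ((\<lambda>t. F (x + t *\<^sub>R (h *\<^sub>R v))) has_vector_derivative d) (at t) \<and>
          (\<forall>M\<in>J (x + t *\<^sub>R (h *\<^sub>R v)). d = blinfun_apply M (h *\<^sub>R v)))"
        assume th: "\<And>t. t \<in> {0..1} \<Longrightarrow> \<exists>d. \<forall>M\<in>J (x + t *\<^sub>R (h *\<^sub>R v)). d = blinfun_apply M (h *\<^sub>R v) \<Longrightarrow> thesis"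
        show thesis
        proof (rule ccontr)
          assume "\<not> thesis"
          have "AE t in lborel. t \<notin> {0..1::real}"
            by (rule eventually_mono[OF AE]) (use th \<open>\<not> thesis\<close> in blast)
          then have "emeasure lborel {0..1::real} = 0"
            by (subst (asm) AE_iff_measurable[of "{0..1}"]) auto
          then show False by simp
        qed
      qed
      have "norm (blinfun_apply M v - blinfun_apply N v) < 1 / Suc k"
        if "M \<in> J (x + t *\<^sub>R (h *\<^sub>R v))" "N \<in> J (x + t *\<^sub>R (h *\<^sub>R v))" for M N
      proof -
        have "blinfun_apply M (h *\<^sub>R v) = blinfun_apply N (h *\<^sub>R v)" using d that by metis
        then show ?thesis using h by (simp add: blinfun.scaleR_right)
      qed
      then have "x + t *\<^sub>R (h *\<^sub>R v) \<in> Osc v k \<inter> ?S"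
        using subsetD[OF SD cD[OF t]] cD[OF t] unfolding Osc_def by blast
      moreover have "dist (x + t *\<^sub>R (h *\<^sub>R v)) x < \<rho>" using c[OF t] by (simp add: dist_commute)
      ultimately show "\<exists>y\<in>Osc v k \<inter> ?S. dist y x < \<rho>" by blast
    qed
    then have "closure (ball z (e / 2)) \<subseteq> closure (Osc v k \<inter> ?S)"
      by (intro closure_minimal) auto
    then show ?thesis using e by simp
  qed
  have "countable ?G"
  proof -
    have "?G = (\<lambda>(v, k). Osc v k \<inter> ?S) ` (Basis \<times> UNIV)" by auto
    then show ?thesis by (simp add: countable_finite)
  qed
  then have "?S \<subseteq> closure (\<Inter>?G)" by (rule Baire[OF closed_cball]) (use ope dense in blast)
  moreover have "z \<in> ?S" using e by simp
  ultimately have "\<Inter>?G \<noteq> {}" by (metis closure_empty empty_iff subsetD)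
  then obtain s where s: "\<And>v k. v \<in> Basis \<Longrightarrow> s \<in> Osc v k \<inter> ?S" by blast
  have sS: "s \<in> ?S" using s nonempty_Basis by blast
  then obtain M where M: "M \<in> J s" using conservative_jacobian_nonempty[OF J] SD by blast
  have "N = M" if N: "N \<in> J s" for N
  proof (rule blinfun_euclidean_eqI)
    fix v :: 'a assume v: "v \<in> Basis"
    have lt: "norm (blinfun_apply N v - blinfun_apply M v) < 1 / Suc k" for k
      using s[OF v, of k] M N by (auto simp: Osc_def)
    show "blinfun_apply N v = blinfun_apply M v"
    proof (rule ccontr)
      assume "blinfun_apply N v \<noteq> blinfun_apply M v"
      then obtain k where "inverse (real (Suc k)) < norm (blinfun_apply N v - blinfun_apply M v)"
        using reals_Archimedean[of "norm (blinfun_apply N v - blinfun_apply M v)"] by auto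
      then show False using lt[of k] by (simp add: inverse_eq_divide)
    qed
  qed
  then have "J s = {M}" using M by blast
  moreover have "s \<in> ball z e" using sS e by auto
  ultimately show thesis using that by blast
qed

section \<open>Clarke Jacobians\<close>

text \<open>Difference quotients along \<open>v\<close> converge to the value of \<open>M\<close> at
  \<open>v\<close>, and for small \<open>h\<close> they lie in the closed ball of radius
  \<open>\<epsilon>\<close> about \<open>d\<close>.\<close>

lemma has_derivative_direction_bound:
  assumes F: "(F has_derivative blinfun_apply M) (at s)" and \<delta>: "\<delta> > 0"
    and le: "\<And>h. 0 < h \<Longrightarrow> h < \<delta> \<Longrightarrow> norm (F (s + h *\<^sub>R v) - F s - h *\<^sub>R d) \<le> h * \<epsilon>"
  shows "norm (blinfun_apply M v - d) \<le> \<epsilon>"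
proof (rule field_le_epsilon)
  fix \<eta> :: real assume "\<eta> > 0"
  \<comment> \<open>\<open>norm v + 1\<close> in place of \<open>norm v\<close> covers
    \<open>v = 0\<close>.\<close>
  define e where "e = \<eta> / (norm v + 1)"
  have nv: "norm v + 1 > 0" by (simp add: add_nonneg_pos)
  then have e: "e > 0" using \<open>\<eta> > 0\<close> by (simp add: e_def)
  have e_le: "e * norm v \<le> \<eta>"
  proof -
    have "e * norm v \<le> e * (norm v + 1)" using e by (intro mult_left_mono) auto
    also have "\<dots> = \<eta>" using nv by (simp add: e_def)
    finally show ?thesis .
  qed
  obtain r where r: "r > 0"
    "\<And>y. norm (y - s) < r \<Longrightarrow> norm (F y - F s - blinfun_apply M (y - s)) \<le> e * norm (y - s)"
    using F e unfolding has_derivative_at_alt by blast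
  define h where "h = min (\<delta> / 2) (r / (2 * (norm v + 1)))"
  have h: "h > 0" "h < \<delta>" using \<delta> r nv by (auto simp: h_def)
  have "h * norm v \<le> r / (2 * (norm v + 1)) * (norm v + 1)"
    unfolding h_def using r nv by (intro mult_mono) auto
  also have "\<dots> = r / 2" using nv by (simp add: field_simps)
  finally have "norm ((s + h *\<^sub>R v) - s) < r" using h r by simp
  from r(2)[OF this] have 1: "norm (F (s + h *\<^sub>R v) - F s - h *\<^sub>R blinfun_apply M v) \<le> e * (h * norm v)"
    using h by (simp add: blinfun.scaleR_right)
  have "h * norm (blinfun_apply M v - d) = norm (h *\<^sub>R (blinfun_apply M v - d))" using h by simp
  also have "h *\<^sub>R (blinfun_apply M v - d) = (F (s + h *\<^sub>R v) - F s - h *\<^sub>R d)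
      - (F (s + h *\<^sub>R v) - F s - h *\<^sub>R blinfun_apply M v)" by (simp add: algebra_simps)
  also have "norm \<dots> \<le> h * \<epsilon> + e * (h * norm v)"
    using norm_triangle_le_diff[OF add_mono[OF le[OF h] 1]] .
  also have "\<dots> = h * (\<epsilon> + e * norm v)" by (simp add: algebra_simps)
  finally have "norm (blinfun_apply M v - d) \<le> \<epsilon> + e * norm v" using h by simp
  then show "norm (blinfun_apply M v - d) \<le> \<epsilon> + \<eta>" using e_le by simp
qed

text \<open>The Bouligand Jacobian, that is, the Clarke Jacobian before convexification. As a slice
  of a closure it has a closed graph by construction.\<close>

definition limiting_jacobian ::
  "'a::euclidean_space set \<Rightarrow> ('a \<Rightarrow> 'b::euclidean_space) \<Rightarrow> 'a \<Rightarrow> ('a \<Rightarrow>\<^sub>L 'b) set" where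
  "limiting_jacobian D F z =
     {M. (z, M) \<in> closure {(s, N). s \<in> D \<and> (F has_derivative blinfun_apply N) (at s)}}"

lemma clarke_jacobian_eq: "clarke_jacobian D F z = convex hull (limiting_jacobian D F z)"
proof -
  have "M \<in> limiting_jacobian D F z \<longleftrightarrow>
      (\<exists>s Ms. (\<forall>j. s j \<in> D \<and> (F has_derivative blinfun_apply (Ms j)) (at (s j))) \<and>
        s \<longlonglongrightarrow> z \<and> Ms \<longlonglongrightarrow> M)" for M
  proof
    assume "M \<in> limiting_jacobian D F z"
    then obtain x where x: "\<And>n. x n \<in> {(s, N). s \<in> D \<and> (F has_derivative blinfun_apply N) (at s)}"
      "x \<longlonglongrightarrow> (z, M)" unfolding limiting_jacobian_def closure_sequential by auto
    then show "\<exists>s Ms. (\<forall>j. s j \<in> D \<and> (F has_derivative blinfun_apply (Ms j)) (at (s j))) \<and>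
        s \<longlonglongrightarrow> z \<and> Ms \<longlonglongrightarrow> M"
      using tendsto_fst[OF x(2)] tendsto_snd[OF x(2)]
      by (intro exI[of _ "\<lambda>n. fst (x n)"] exI[of _ "\<lambda>n. snd (x n)"]) (auto simp: case_prod_beta)
  next
    assume "\<exists>s Ms. (\<forall>j. s j \<in> D \<and> (F has_derivative blinfun_apply (Ms j)) (at (s j))) \<and>
        s \<longlonglongrightarrow> z \<and> Ms \<longlonglongrightarrow> M"
    then obtain s Ms where *: "\<forall>j. s j \<in> D \<and> (F has_derivative blinfun_apply (Ms j)) (at (s j))"
      "s \<longlonglongrightarrow> z" "Ms \<longlonglongrightarrow> M" by blast
    then show "M \<in> limiting_jacobian D F z"
      unfolding limiting_jacobian_def closure_sequential
      by (auto intro!: exI[of _ "\<lambda>n. (s n, Ms n)"] tendsto_Pair)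
  qed
  then have "limiting_jacobian D F z =
    {M. \<exists>s Ms. (\<forall>j. s j \<in> D \<and> (F has_derivative blinfun_apply (Ms j)) (at (s j))) \<and>
        s \<longlonglongrightarrow> z \<and> Ms \<longlonglongrightarrow> M}" by blast
  then show ?thesis by (simp add: clarke_jacobian_def)
qed

lemma limiting_subset_clarke_jacobian: "limiting_jacobian D F z \<subseteq> clarke_jacobian D F z"
  unfolding clarke_jacobian_eq by (rule hull_subset)

text \<open>Closed conditions pass to limits of derivatives, convex ones to the hull. The norm
  bound, the contraction bound and the values in a given direction all reach the Clarke Jacobian
  this way.\<close>

lemma clarke_jacobian_subset:
  assumes K: "closed K" "convex K" and \<delta>: "\<delta> > 0"
    and sub: "\<And>s M. s \<in> ball z \<delta> \<Longrightarrow> s \<in> D \<Longrightarrow> (F has_derivative blinfun_apply M) (at s) \<Longrightarrow> M \<in> K"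
  shows "clarke_jacobian D F z \<subseteq> K"
  unfolding clarke_jacobian_def
proof (rule hull_minimal[where S = convex], clarify)
  show "convex K" by (rule K(2))
  fix M s Ms
  assume *: "\<forall>j. s j \<in> D \<and> (F has_derivative blinfun_apply (Ms j)) (at (s j))"
    "s \<longlonglongrightarrow> z" "Ms \<longlonglongrightarrow> M"
  have "eventually (\<lambda>j. s j \<in> ball z \<delta>) sequentially"
    using *(2) \<delta> by (simp add: tendsto_iff dist_commute)
  then have "eventually (\<lambda>j. Ms j \<in> K) sequentially"
    by eventually_elim (use sub * in blast)
  then show "M \<in> K" using Lim_in_closed_set[OF K(1) _ _ *(3)] by simp
qed

lemma closed_convex_blinfun_apply_cball:
  fixes v :: "'a::real_normed_vector" and d :: "'b::real_normed_vector"
  shows "closed {N :: 'a \<Rightarrow>\<^sub>L 'b. norm (blinfun_apply N v - d) \<le> \<epsilon>}"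
    and "convex {N :: 'a \<Rightarrow>\<^sub>L 'b. norm (blinfun_apply N v - d) \<le> \<epsilon>}"
proof -
  show "closed {N :: 'a \<Rightarrow>\<^sub>L 'b. norm (blinfun_apply N v - d) \<le> \<epsilon>}"
    by (intro closed_Collect_le continuous_intros)
  have "linear (\<lambda>N :: 'a \<Rightarrow>\<^sub>L 'b. blinfun_apply N v)"
    by (rule bounded_linear.linear[OF blinfun.bounded_linear_left])
  then have "convex ((\<lambda>N :: 'a \<Rightarrow>\<^sub>L 'b. blinfun_apply N v) -` cball d \<epsilon>)"
    by (rule convex_linear_vimage) simp
  moreover have "(\<lambda>N :: 'a \<Rightarrow>\<^sub>L 'b. blinfun_apply N v) -` cball d \<epsilon>
      = {N. norm (blinfun_apply N v - d) \<le> \<epsilon>}"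
    by (auto simp: dist_norm norm_minus_commute)
  ultimately show "convex {N :: 'a \<Rightarrow>\<^sub>L 'b. norm (blinfun_apply N v - d) \<le> \<epsilon>}" by simp
qed

lemma clarke_jacobian_locally_bounded:
  assumes F: "locally_lipschitz_on D F" and D: "open D" "z \<in> D"
  shows "\<exists>e>0. \<exists>B. \<forall>w\<in>ball z e \<inter> D. \<forall>M\<in>clarke_jacobian D F w. norm M \<le> B"
proof -
  obtain e L where e: "e > 0" and L: "L-lipschitz_on (ball z e \<inter> D) F"
    using F D unfolding locally_lipschitz_on_def by blast
  have "clarke_jacobian D F w \<subseteq> cball 0 L" if w: "w \<in> ball z e \<inter> D" for w
  proof -
    have U: "open (ball z e \<inter> D)" using D by auto
    obtain \<delta> where \<delta>: "\<delta> > 0" "ball w \<delta> \<subseteq> ball z e \<inter> D"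
      using U w open_contains_ball by metis
    show ?thesis
    proof (rule clarke_jacobian_subset[OF closed_cball convex_cball \<delta>(1)])
      fix s M assume s: "s \<in> ball w \<delta>" and M: "(F has_derivative blinfun_apply M) (at s)"
      have "norm (blinfun_apply M v) \<le> L * norm v" for v
      proof -
        obtain r where r: "r > 0" "ball s r \<subseteq> ball z e \<inter> D" using s \<delta> U open_contains_ball by (metis subsetD)
        have "norm (blinfun_apply M v - 0) \<le> L * norm v"
        \<comment> \<open>For \<open>h\<close> below this bound, \<open>s + h *\<^sub>R v\<close>
          stays in \<open>ball s r\<close>, where the Lipschitz estimate holds.\<close>
        proof (rule has_derivative_direction_bound[OF M, of "r / (norm v + 1)"])
          show "r / (norm v + 1) > 0" using r by (simp add: add_nonneg_pos)
          fix h :: real assume h: "0 < h" "h < r / (norm v + 1)"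
          have "h * norm v \<le> h * (norm v + 1)" using h by simp
          also have "\<dots> < r" using h by (simp add: pos_less_divide_eq add_nonneg_pos)
          finally have "s + h *\<^sub>R v \<in> ball s r" using h by (simp add: dist_norm)
          moreover have "s \<in> ball s r" using r by simp
          ultimately have "dist (F (s + h *\<^sub>R v)) (F s) \<le> L * dist (s + h *\<^sub>R v) s"
            using r(2) lipschitz_onD[OF L] by blast
          then show "norm (F (s + h *\<^sub>R v) - F s - h *\<^sub>R 0) \<le> h * (L * norm v)"
            using h by (simp add: dist_norm algebra_simps)
        qed
        then show ?thesis by simp
      qed
      then show "M \<in> cball 0 L"
        using norm_blinfun_bound[OF lipschitz_on_nonneg[OF L], of M] by simp
    qed
  qed
  then show ?thesis using e by fastforce
qed

text \<open>Caratheodory's theorem is available only for Euclidean spaces, and the type of bounded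
  linear maps is not one.\<close>

lemma closed_convex_hull_if_embedding:
  fixes f :: "'a::real_normed_vector \<Rightarrow> 'b::euclidean_space"
    and S :: "'a set"
  assumes f: "linear f" "continuous_on UNIV f" "inj f" and S: "compact S"
  shows "closed (convex hull S)"
proof -
  have "compact (f ` S)" using S f(2) continuous_on_subset compact_continuous_image by blast
  then have "closed (convex hull (f ` S))" by (intro compact_imp_closed compact_convex_hull)
  then have "closed (f -` (f ` (convex hull S)))"
    unfolding convex_hull_linear_image[OF f(1)] using f(2) by (rule closed_vimage)
  then show ?thesis by (simp add: inj_vimage_image_eq[OF f(3)])
qed

lemma limiting_jacobian_closed_graph:
  "closedin (top_of_set (D \<times> UNIV)) {(z, M). z \<in> D \<and> M \<in> limiting_jacobian D F z}"
proof -
  let ?C = "closure {(s, N). s \<in> D \<and> (F has_derivative blinfun_apply N) (at s)}"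
  have "{(z, M). z \<in> D \<and> M \<in> limiting_jacobian D F z} = D \<times> UNIV \<inter> ?C"
    by (auto simp: limiting_jacobian_def)
  then show ?thesis unfolding closedin_closed using closed_closure by blast
qed

lemma limiting_jacobian_locally_bounded:
  assumes "locally_lipschitz_on D F" "open D" "z \<in> D"
  shows "\<exists>e>0. \<exists>B. \<forall>w\<in>ball z e \<inter> D. \<forall>M\<in>limiting_jacobian D F w. norm M \<le> B"
proof -
  obtain e B where "e > 0" "\<forall>w\<in>ball z e \<inter> D. \<forall>M\<in>clarke_jacobian D F w. norm M \<le> B"
    using clarke_jacobian_locally_bounded[OF assms] by blast
  then show ?thesis
    by (intro exI[of _ e] conjI exI[of _ B]) (auto dest: subsetD[OF limiting_subset_clarke_jacobian])
qed

text \<open>The limiting Jacobians at \<open>z\<close> form a slice of a closed set and are bounded,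
  hence compact; \<open>f\<close> carries their hull into a Euclidean space.\<close>

lemma clarke_jacobian_closed:
  fixes F :: "'a::euclidean_space \<Rightarrow> 'b::euclidean_space"
    and f :: "('a \<Rightarrow>\<^sub>L 'b) \<Rightarrow> 'c::euclidean_space"
  assumes f: "linear f" "continuous_on UNIV f" "inj f"
    and F: "locally_lipschitz_on D F" "open D" "z \<in> D"
  shows "closed (clarke_jacobian D F z)"
  unfolding clarke_jacobian_eq
proof (rule closed_convex_hull_if_embedding[OF f])
  have "limiting_jacobian D F z = Pair z -` closure {(s, N). s \<in> D \<and> (F has_derivative blinfun_apply N) (at s)}"
    by (auto simp: limiting_jacobian_def)
  then have "closed (limiting_jacobian D F z)"
    by (simp only:) (intro closed_vimage closed_closure continuous_intros)
  moreover have "bounded (limiting_jacobian D F z)"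
    using limiting_jacobian_locally_bounded[OF F] F(3) by (fastforce simp: bounded_iff)
  ultimately show "compact (limiting_jacobian D F z)" by (simp add: compact_eq_bounded_closed)
qed

text \<open>An open convex neighbourhood of the Clarke Jacobian at \<open>z\<close> contains the
  limiting Jacobians at nearby points by upper semicontinuity, hence also their hulls.\<close>

lemma clarke_jacobian_limit:
  assumes F: "locally_lipschitz_on D F" "open D" and z: "z \<in> D"
    and cl: "closed (clarke_jacobian D F z)"
    and s: "\<And>k. s k \<in> D" "s \<longlonglongrightarrow> z" and M: "\<And>k. M k \<in> clarke_jacobian D F (s k)" "M \<longlonglongrightarrow> N"
  shows "N \<in> clarke_jacobian D F z"
proof -
  let ?C = "clarke_jacobian D F z"
  have "\<exists>y\<in>?C. dist y N < e" if "e > 0" for e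
  proof -
    \<comment> \<open>Written as a Minkowski sum the neighbourhood is visibly convex, as a union of
      balls visibly open.\<close>
    let ?U = "\<Union>x\<in>?C. \<Union>y\<in>ball 0 (e / 2). {x + y}"
    have U: "?U = (\<Union>x\<in>?C. ball x (e / 2))"
    proof (intro set_eqI iffI)
      fix w assume "w \<in> (\<Union>x\<in>?C. ball x (e / 2))"
      then obtain x where x: "x \<in> ?C" "dist x w < e / 2" by auto
      then have "w - x \<in> ball 0 (e / 2)" "w = x + (w - x)" by (auto simp: dist_norm norm_minus_commute)
      then show "w \<in> ?U" using x by blast
    next
      fix w assume "w \<in> ?U"
      then obtain x y where "x \<in> ?C" "y \<in> ball 0 (e / 2)" "w = x + y" by blast
      then show "w \<in> (\<Union>x\<in>?C. ball x (e / 2))"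
        by (intro UN_I[of x]) (auto simp: dist_norm)
    qed
    have "open ?U" unfolding U by auto
    moreover have "convex ?U"
      by (intro convex_sums convex_ball) (simp add: clarke_jacobian_eq convex_convex_hull)
    moreover have "limiting_jacobian D F z \<subseteq> ?U"
      unfolding U using limiting_subset_clarke_jacobian that by fastforce
    ultimately obtain \<delta> where \<delta>: "\<delta> > 0" "\<And>u. u \<in> ball z \<delta> \<inter> D \<Longrightarrow> limiting_jacobian D F u \<subseteq> ?U"
      using closed_graph_upper_semicontinuous[OF limiting_jacobian_locally_bounded[OF F z]
        limiting_jacobian_closed_graph z] by metis
    have "eventually (\<lambda>k. dist (s k) z < \<delta> \<and> dist (M k) N < e / 2) sequentially"
      using tendstoD[OF s(2) \<delta>(1)] tendstoD[OF M(2), of "e / 2"] that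
      by (intro eventually_conj) auto
    then obtain k where k: "dist (s k) z < \<delta>" "dist (M k) N < e / 2"
      using eventually_happens'[OF sequentially_bot] by blast
    have "clarke_jacobian D F (s k) \<subseteq> ?U"
      unfolding clarke_jacobian_eq[of D F "s k"]
    proof (rule hull_minimal[where S = convex])
      show "limiting_jacobian D F (s k) \<subseteq> ?U"
        by (rule \<delta>(2)) (use k(1) s(1) in \<open>simp add: dist_commute\<close>)
    qed fact
    then obtain x where x: "x \<in> ?C" "dist x (M k) < e / 2" using M(1) unfolding U by fastforce
    then have "dist x N < e" using k(2) dist_triangle[of x N "M k"] by linarith
    then show ?thesis using x(1) by blast
  qed
  then show ?thesis using closed_approachable[OF cl] by blast
qed

text \<open>Points where \<open>J\<close> is a singleton accumulate at \<open>z\<close>. There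
  \<open>F\<close> is differentiable with derivative in \<open>J\<close>, and local boundedness of
  \<open>J\<close> yields a limit of these derivatives.\<close>

lemma clarke_jacobian_nonempty:
  fixes F :: "'a::euclidean_space \<Rightarrow> 'b::euclidean_space"
  assumes J: "conservative_jacobian_on D F J" and F: "locally_lipschitz_on D F"
    and D: "open D" "z \<in> D"
  shows "clarke_jacobian D F z \<noteq> {}"
proof -
  obtain e where e: "e > 0" "ball z e \<subseteq> D" using D open_contains_ball by blast
  have "\<exists>s M. s \<in> ball z (e / Suc k) \<and> J s = {M}" for k :: nat
  proof -
    have "e / Suc k \<le> e" using e by (simp add: field_simps)
    then have "ball z (e / Suc k) \<subseteq> D" using e by auto
    then show ?thesis using conservative_jacobian_singleton_dense[OF J, of "e / Suc k" z] e
      by (metis divide_pos_pos of_nat_0_less_iff zero_less_Suc)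
  qed
  then obtain s M where s: "\<And>k. s k \<in> ball z (e / Suc k)" and M: "\<And>k. J (s k) = {M k}" by metis
  have sD: "s k \<in> D" for k
  proof -
    have "e / Suc k \<le> e" using e by (simp add: field_simps)
    then show ?thesis using s[of k] e by auto
  qed
  have lim: "s \<longlonglongrightarrow> z" by (rule LIMSEQ_shrinking_balls[OF s])
  obtain N r where N: "strict_mono r" "(M \<circ> r) \<longlonglongrightarrow> N"
    using closed_graph_subseq[OF conservative_jacobian_bounded[OF J D(2)]
      conservative_jacobian_closed_graph[OF J] D(2) sD lim, of M] M
    by (metis singletonI)
  have "(z, N) \<in> closure {(s, N). s \<in> D \<and> (F has_derivative blinfun_apply N) (at s)}"
    unfolding closure_sequential
  proof (intro exI[of _ "\<lambda>k. ((s \<circ> r) k, (M \<circ> r) k)"] conjI allI)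
    show "(\<lambda>k. ((s \<circ> r) k, (M \<circ> r) k)) \<longlonglongrightarrow> (z, N)"
      by (intro tendsto_Pair LIMSEQ_subseq_LIMSEQ[OF lim N(1)] N(2))
    show "((s \<circ> r) k, (M \<circ> r) k) \<in> {(s, N). s \<in> D \<and> (F has_derivative blinfun_apply N) (at s)}" for k
      using sD conservative_jacobian_singleton_imp_has_derivative[OF J F D(1) sD M] by simp
  qed
  then have "N \<in> limiting_jacobian D F z" by (simp add: limiting_jacobian_def)
  then show ?thesis using limiting_subset_clarke_jacobian by blast
qed

text \<open>At a point where \<open>J\<close> is single-valued in direction \<open>v\<close>, \<open>F\<close> is strictly differentiable in
  that direction, so the Clarke Jacobian agrees with \<open>J\<close> on \<open>v\<close>.\<close>

lemma clarke_jacobian_apply_eq: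
  fixes F :: "'a::euclidean_space \<Rightarrow> 'b::euclidean_space"
  assumes J: "conservative_jacobian_on D F J" and F: "locally_lipschitz_on D F"
    and D: "open D" "z \<in> D" and Jv: "\<And>N. N \<in> J z \<Longrightarrow> blinfun_apply N v = d"
    and M: "M \<in> clarke_jacobian D F z"
  shows "blinfun_apply M v = d"
proof -
  have "norm (blinfun_apply M v - d) \<le> 0 + \<epsilon>" if \<epsilon>: "\<epsilon> > 0" for \<epsilon>
  proof -
    \<comment> \<open>The open \<open>?U\<close> serves the upper semicontinuity of
      \<open>J\<close>; the closed convex \<open>?K\<close> survives limits and hulls.\<close>
    let ?U = "{N :: 'a \<Rightarrow>\<^sub>L 'b. norm (blinfun_apply N v - d) < \<epsilon>}"
      and ?K = "{N :: 'a \<Rightarrow>\<^sub>L 'b. norm (blinfun_apply N v - d) \<le> \<epsilon>}"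
    have "open ?U" by (intro open_Collect_less continuous_intros)
    moreover have "J z \<subseteq> ?U" using Jv \<epsilon> by auto
    ultimately obtain \<delta> where \<delta>: "\<delta> > 0" "\<And>u. u \<in> ball z \<delta> \<inter> D \<Longrightarrow> J u \<subseteq> ?U"
      using closed_graph_upper_semicontinuous[OF conservative_jacobian_bounded[OF J D(2)]
        conservative_jacobian_closed_graph[OF J] D(2), of ?U] by blast
    have "clarke_jacobian D F z \<subseteq> ?K"
    proof (rule clarke_jacobian_subset[OF closed_convex_blinfun_apply_cball \<delta>(1)])
      fix s N assume s: "s \<in> ball z \<delta>" "s \<in> D" and N: "(F has_derivative blinfun_apply N) (at s)"
      have "open (ball z \<delta> \<inter> D)" using D by auto
      then obtain r where r: "r > 0" "ball s r \<subseteq> ball z \<delta> \<inter> D"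
        using s open_contains_ball by (metis IntI)
      have "norm (blinfun_apply N v - d) \<le> \<epsilon>"
      proof (rule has_derivative_direction_bound[OF N, of "r / (norm v + 1)"])
        show "r / (norm v + 1) > 0" using r by (simp add: add_nonneg_pos)
        fix h :: real assume h: "0 < h" "h < r / (norm v + 1)"
        have "h * norm v \<le> h * (norm v + 1)" using h by simp
        also have "\<dots> < r" using h by (simp add: pos_less_divide_eq add_nonneg_pos)
        finally have "s + h *\<^sub>R v \<in> ball s r" using h by (simp add: dist_norm)
        moreover have "s \<in> ball s r" using r by simp
        ultimately have seg: "closed_segment s (s + h *\<^sub>R v) \<subseteq> ball z \<delta> \<inter> D"
          using closed_segment_subset[OF _ _ convex_ball] r by blast
        show "norm (F (s + h *\<^sub>R v) - F s - h *\<^sub>R d) \<le> h * \<epsilon>"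
        proof (rule conservative_jacobian_increment[OF J F])
          fix u P assume "u \<in> closed_segment s (s + h *\<^sub>R v)" "P \<in> J u"
          then have "norm (blinfun_apply P v - d) < \<epsilon>" using \<delta>(2) seg by blast
          then have "h * norm (blinfun_apply P v - d) \<le> h * \<epsilon>" using h by simp
          then show "norm (blinfun_apply P (h *\<^sub>R v) - h *\<^sub>R d) \<le> h * \<epsilon>"
            using h by (simp add: blinfun.scaleR_right flip: scaleR_diff_right)
        qed (use seg in auto)
      qed
      then show "N \<in> ?K" by simp
    qed
    then show ?thesis using M by auto
  qed
  then have "norm (blinfun_apply M v - d) \<le> 0" by (rule field_le_epsilon)
  then show ?thesis by simp
qed

text \<open>\<open>f\<close> lists the columns of the matrix, one Cartesian power per factor of the
  domain. It is the embedding that \<open>clarke_jacobian_closed\<close> takes as input.\<close>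

lemma blinfun_cart_embedding:
  obtains f :: "(((real^'p) \<times> (real^'n) \<times> (real^'m)) \<Rightarrow>\<^sub>L 'z::euclidean_space) \<Rightarrow> ('z^'p) \<times> ('z^'n) \<times> ('z^'m)"
  where "linear f" "continuous_on UNIV f" "inj f"
proof
  let ?f = "\<lambda>M :: ((real^'p) \<times> (real^'n) \<times> (real^'m)) \<Rightarrow>\<^sub>L 'z.
    (\<chi> i. blinfun_apply M (axis i 1, 0, 0), \<chi> i. blinfun_apply M (0, axis i 1, 0),
     \<chi> i. blinfun_apply M (0, 0, axis i 1))"
  show "linear ?f"
    by (intro linearI) (auto simp: vec_eq_iff blinfun.add_left blinfun.scaleR_left)
  show "continuous_on UNIV ?f" by (intro continuous_intros)
  show "inj ?f"
  proof (rule injI)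
    fix M N assume "?f M = ?f N"
    then have "blinfun_apply M (axis i 1, 0, 0) = blinfun_apply N (axis i 1, 0, 0)"
      "blinfun_apply M (0, axis j 1, 0) = blinfun_apply N (0, axis j 1, 0)"
      "blinfun_apply M (0, 0, axis k 1) = blinfun_apply N (0, 0, axis k 1)" for i j k
      by (auto simp: vec_eq_iff)
    then show "M = N"
      by (intro blinfun_euclidean_eqI) (auto simp: Basis_prod_def Basis_vec_def zero_prod_def)
  qed
qed

section \<open>Fixed points of parametrised contractions\<close>

lemma jac_block_U_apply: "blinfun_apply (jac_block_U M) \<theta> = blinfun_apply M (\<theta>, 0)"
  unfolding jac_block_U_def
  by (subst bounded_linear_Blinfun_apply)
    (auto intro!: bounded_linear_compose[OF blinfun.bounded_linear_right] bounded_linear_Pair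
      bounded_linear_ident bounded_linear_zero)

lemma jac_block_V_apply: "blinfun_apply (jac_block_V M) z = blinfun_apply M (0, z)"
  unfolding jac_block_V_def
  by (subst bounded_linear_Blinfun_apply)
    (auto intro!: bounded_linear_compose[OF blinfun.bounded_linear_right] bounded_linear_Pair
      bounded_linear_ident bounded_linear_zero)

lemma blinfun_apply_Pair: "blinfun_apply M (a, b) = blinfun_apply M (a, 0) + blinfun_apply M (0, b)"
  by (simp flip: blinfun.add_right)

context
  fixes M :: "('p::euclidean_space \<times> 'z::euclidean_space) \<Rightarrow>\<^sub>L 'z" and q :: real
  assumes contraction: "\<And>z. norm (blinfun_apply M (0, z)) \<le> q * norm z" and q: "q < 1"
begin

text \<open>A kernel vector satisfies \<open>norm z \<le> q * norm z\<close> and so vanishes; in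
  finite dimension an injective endomorphism is bijective.\<close>

lemma bij_id_minus_jac_block_V: "bij (blinfun_apply (id_blinfun - jac_block_V M))"
proof -
  let ?f = "blinfun_apply (id_blinfun - jac_block_V M)"
  have lin: "linear ?f" by (rule bounded_linear.linear[OF blinfun.bounded_linear_right])
  have "inj ?f"
    unfolding linear_injective_0[OF lin]
  proof (intro allI impI)
    fix z assume "?f z = 0"
    then have "z = blinfun_apply M (0, z)" by (simp add: blinfun.diff_left jac_block_V_apply)
    then have "norm z \<le> q * norm z" using contraction[of z] by simp
    then have "(1 - q) * norm z \<le> 0" by (simp add: algebra_simps)
    then show "z = 0" using q by (simp add: mult_le_0_iff)
  qed
  then show ?thesis using linear_injective_imp_surjective[OF lin] by (simp add: bij_def)
qed

text \<open>This is \<open>(Id - V) w = U \<theta>\<close> in fixed point form; together with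
  uniqueness it stands in for the inverse in the later arguments.\<close>

lemma implicit_jac_fixed_point:
  "blinfun_apply (implicit_jac M) \<theta> = blinfun_apply M (\<theta>, blinfun_apply (implicit_jac M) \<theta>)"
proof -
  let ?f = "blinfun_apply (id_blinfun - jac_block_V M)"
  have lin: "linear ?f" by (rule bounded_linear.linear[OF blinfun.bounded_linear_right])
  \<comment> \<open>\<open>Blinfun\<close> is meaningful only on bounded linear maps.\<close>
  have "linear (inv ?f)"
    using inj_linear_imp_inv_linear[OF lin] bij_id_minus_jac_block_V by (simp add: bij_def)
  then have "bounded_linear (inv ?f \<circ> blinfun_apply (jac_block_U M))"
    unfolding comp_def linear_conv_bounded_linear
    by (rule bounded_linear_compose[OF _ blinfun.bounded_linear_right])
  then have w: "blinfun_apply (implicit_jac M) \<theta> = inv ?f (blinfun_apply M (\<theta>, 0))"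
    by (simp add: implicit_jac_def bounded_linear_Blinfun_apply jac_block_U_apply)
  have "?f (blinfun_apply (implicit_jac M) \<theta>) = blinfun_apply M (\<theta>, 0)"
    unfolding w using bij_id_minus_jac_block_V by (simp add: bij_def surj_f_inv_f)
  then show ?thesis
    by (subst blinfun_apply_Pair) (simp add: blinfun.diff_left jac_block_V_apply algebra_simps)
qed

lemma implicit_jac_unique:
  assumes "w = blinfun_apply M (\<theta>, w)"
  shows "w = blinfun_apply (implicit_jac M) \<theta>"
proof -
  let ?w = "blinfun_apply (implicit_jac M) \<theta>"
  have "w - ?w = blinfun_apply M (\<theta>, w) - blinfun_apply M (\<theta>, ?w)"
    using assms implicit_jac_fixed_point by metis
  also have "\<dots> = blinfun_apply M (0, w - ?w)" by (simp flip: blinfun.diff_right)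
  finally have "norm (w - ?w) \<le> q * norm (w - ?w)" using contraction by metis
  then have "(1 - q) * norm (w - ?w) \<le> 0" by (simp add: algebra_simps)
  then show ?thesis using q by (simp add: mult_le_0_iff)
qed

lemma norm_implicit_jac_le: "norm (implicit_jac M) \<le> norm M / (1 - q)"
proof (rule norm_blinfun_bound)
  show "norm M / (1 - q) \<ge> 0" using q by simp
  fix \<theta>
  let ?w = "blinfun_apply (implicit_jac M) \<theta>"
  have "norm ?w = norm (blinfun_apply M (\<theta>, 0) + blinfun_apply M (0, ?w))"
    using implicit_jac_fixed_point blinfun_apply_Pair by metis
  also have "\<dots> \<le> norm M * norm \<theta> + q * norm ?w"
    using norm_triangle_mono[OF norm_blinfun[of M "(\<theta>, 0)"] contraction] by simp
  finally have "norm ?w * (1 - q) \<le> norm M * norm \<theta>" by (simp add: algebra_simps)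
  then show "norm ?w \<le> norm M / (1 - q) * norm \<theta>" using q by (simp add: pos_le_divide_eq)
qed

end

section \<open>Regularity of the fixed point map\<close>

lemma locally_lipschitz_on_imp_continuous_on:
  assumes "locally_lipschitz_on D F"
  shows "continuous_on D F"
  unfolding continuous_on_iff
proof (intro ballI allI impI)
  fix x and e :: real assume x: "x \<in> D" and "e > 0"
  obtain r L where r: "r > 0" and L: "L-lipschitz_on (ball x r \<inter> D) F"
    using assms x unfolding locally_lipschitz_on_def by blast
  have "continuous_on (ball x r \<inter> D) F" by (rule lipschitz_on_continuous_on[OF L])
  then obtain d where d: "d > 0" "\<And>y. y \<in> ball x r \<inter> D \<Longrightarrow> dist y x < d \<Longrightarrow> dist (F y) (F x) < e"
    using x r \<open>e > 0\<close> unfolding continuous_on_iff by (metis IntI centre_in_ball)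
  have "dist (F y) (F x) < e" if "y \<in> D" "dist y x < min r d" for y
    using d(2)[of y] that by (simp add: dist_commute)
  then show "\<exists>d>0. \<forall>y\<in>D. dist y x < d \<longrightarrow> dist (F y) (F x) < e"
    using r d(1) by (metis min_less_iff_conj)
qed

text \<open>Change \<open>z\<close> and \<open>\<theta>\<close> separately in \<open>F\<close>: the
  first change is absorbed by \<open>q < 1\<close>, the second costs \<open>L\<close>, whence
  \<open>K = L / (1 - q)\<close>. As \<open>L\<close> is only local, the fixed points must first be
  kept near \<open>zs \<theta>0\<close>.\<close>

lemma fixed_point_locally_lipschitz:
  fixes F :: "'p::real_normed_vector \<times> 'z::real_normed_vector \<Rightarrow> 'z"
  assumes F: "locally_lipschitz_on (\<Theta> \<times> UNIV) F" and q: "q < 1"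
    and contr: "\<And>\<theta> z w. \<theta> \<in> \<Theta> \<Longrightarrow> norm (F (\<theta>, z) - F (\<theta>, w)) \<le> q * norm (z - w)"
    and fp: "\<And>\<theta>. \<theta> \<in> \<Theta> \<Longrightarrow> F (\<theta>, zs \<theta>) = zs \<theta>"
  shows "locally_lipschitz_on \<Theta> zs"
  unfolding locally_lipschitz_on_def
proof
  fix \<theta>0 assume \<theta>0: "\<theta>0 \<in> \<Theta>"
  obtain e L where e: "e > 0" and L: "L-lipschitz_on (ball (\<theta>0, zs \<theta>0) e \<inter> \<Theta> \<times> UNIV) F"
    using F \<theta>0 unfolding locally_lipschitz_on_def by blast
  define K where "K = L / (1 - q)"
  have K: "K \<ge> 0" using lipschitz_on_nonneg[OF L] q by (simp add: K_def)
  \<comment> \<open>Nearness is demanded of \<open>zs \<theta>'\<close> but not of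
    \<open>zs \<theta>\<close>. With \<open>\<theta>' = \<theta>0\<close> the estimate therefore
    bounds \<open>zs \<theta> - zs \<theta>0\<close> before any continuity of \<open>zs\<close> is
    known.\<close>
  have est: "norm (zs \<theta> - zs \<theta>') \<le> K * norm (\<theta> - \<theta>')"
    if \<theta>: "\<theta> \<in> \<Theta>" "\<theta>' \<in> \<Theta>" and near: "(\<theta>, zs \<theta>') \<in> ball (\<theta>0, zs \<theta>0) e" "(\<theta>', zs \<theta>') \<in> ball (\<theta>0, zs \<theta>0) e"
    for \<theta> \<theta>'
  proof -
    have "zs \<theta> - zs \<theta>' = (F (\<theta>, zs \<theta>) - F (\<theta>, zs \<theta>')) + (F (\<theta>, zs \<theta>') - F (\<theta>', zs \<theta>'))"
      using fp \<theta> by simp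
    then have "norm (zs \<theta> - zs \<theta>') \<le> q * norm (zs \<theta> - zs \<theta>') + norm (F (\<theta>, zs \<theta>') - F (\<theta>', zs \<theta>'))"
      using norm_triangle_mono[OF contr[OF \<theta>(1)] order_refl] by metis
    also have "norm (F (\<theta>, zs \<theta>') - F (\<theta>', zs \<theta>')) \<le> L * norm (\<theta> - \<theta>')"
      using lipschitz_onD[OF L, of "(\<theta>, zs \<theta>')" "(\<theta>', zs \<theta>')"] near \<theta>
      by (simp add: dist_norm)
    finally have "norm (zs \<theta> - zs \<theta>') * (1 - q) \<le> L * norm (\<theta> - \<theta>')" by (simp add: algebra_simps)
    then show ?thesis using q by (simp add: K_def pos_le_divide_eq)
  qed
  have near: "(\<theta>, z) \<in> ball (\<theta>0, zs \<theta>0) e" if "norm (\<theta> - \<theta>0) + norm (z - zs \<theta>0) < e" for \<theta> z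
    using norm_Pair_le[of "\<theta>0 - \<theta>" "zs \<theta>0 - z"] that
    by (simp add: dist_norm norm_minus_commute[of \<theta>0] norm_minus_commute[of "zs \<theta>0"])
  \<comment> \<open>Chosen so that \<open>\<delta> + K * \<delta> = e / 2\<close>: a parameter
    distance below \<open>\<delta>\<close> plus a fixed point distance of at most
    \<open>K * \<delta>\<close> stays below \<open>e\<close>.\<close>
  define \<delta> where "\<delta> = (e / 2) / (K + 1)"
  have \<delta>: "\<delta> > 0" using e K by (simp add: \<delta>_def)
  have "(K + 1) * \<delta> = e / 2" unfolding \<delta>_def using K by (simp del: divide_divide_eq_left)
  then have \<delta>K: "\<delta> + K * \<delta> = e / 2" by (simp add: algebra_simps)
  have K\<delta>: "K * \<delta> \<ge> 0" using K \<delta> by simp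
  have \<delta>e: "\<delta> < e" using e \<delta>K K\<delta> by simp
  have zs_near: "norm (zs \<theta> - zs \<theta>0) \<le> K * \<delta>" if "\<theta> \<in> \<Theta>" "norm (\<theta> - \<theta>0) < \<delta>" for \<theta>
  proof -
    have "norm (zs \<theta> - zs \<theta>0) \<le> K * norm (\<theta> - \<theta>0)"
      using that \<theta>0 e \<delta>e by (intro est near) auto
    also have "\<dots> \<le> K * \<delta>" using that K by (intro mult_left_mono) auto
    finally show ?thesis .
  qed
  have "K-lipschitz_on (ball \<theta>0 \<delta> \<inter> \<Theta>) zs"
  proof (rule lipschitz_onI[OF _ K])
    fix \<theta> \<theta>' assume \<theta>: "\<theta> \<in> ball \<theta>0 \<delta> \<inter> \<Theta>" "\<theta>' \<in> ball \<theta>0 \<delta> \<inter> \<Theta>"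
    then have n: "norm (\<theta> - \<theta>0) < \<delta>" "norm (\<theta>' - \<theta>0) < \<delta>"
      by (auto simp: dist_norm norm_minus_commute)
    then have "norm (zs \<theta>' - zs \<theta>0) \<le> K * \<delta>" using zs_near \<theta> by blast
    then show "dist (zs \<theta>) (zs \<theta>') \<le> K * dist \<theta> \<theta>'"
      unfolding dist_norm using \<theta> n \<delta>K e by (intro est near) auto
  qed
  then show "\<exists>e>0. \<exists>L. L-lipschitz_on (ball \<theta>0 e \<inter> \<Theta>) zs" using \<delta> by blast
qed

text \<open>The contraction property bounds difference quotients in directions
  \<open>(0, z)\<close>, and the resulting bound on derivatives is a closed convex
  condition.\<close>

lemma clarke_jacobian_contraction:
  fixes F :: "'p::euclidean_space \<times> 'z::euclidean_space \<Rightarrow> 'z"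
  assumes contr: "\<And>\<theta> z w. \<theta> \<in> \<Theta> \<Longrightarrow> norm (F (\<theta>, z) - F (\<theta>, w)) \<le> q * norm (z - w)"
    and M: "M \<in> clarke_jacobian (\<Theta> \<times> UNIV) F x"
  shows "norm (blinfun_apply M (0, z)) \<le> q * norm z"
proof -
  have "clarke_jacobian (\<Theta> \<times> UNIV) F x \<subseteq> {N. norm (blinfun_apply N (0, z) - 0) \<le> q * norm z}"
  proof (rule clarke_jacobian_subset[OF closed_convex_blinfun_apply_cball zero_less_one])
    fix s N assume s: "s \<in> \<Theta> \<times> (UNIV :: 'z set)" and N: "(F has_derivative blinfun_apply N) (at s)"
    have "norm (blinfun_apply N (0, z) - 0) \<le> q * norm z"
    proof (rule has_derivative_direction_bound[OF N zero_less_one])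
      fix h :: real assume h: "0 < h"
      obtain \<theta> w where [simp]: "s = (\<theta>, w)" by force
      show "norm (F (s + h *\<^sub>R (0, z)) - F s - h *\<^sub>R 0) \<le> h * (q * norm z)"
        using contr[of \<theta> "w + h *\<^sub>R z" w] s h by (simp add: algebra_simps)
    qed
    then show "N \<in> {N. norm (blinfun_apply N (0, z) - 0) \<le> q * norm z}" by simp
  qed
  then show ?thesis using M by auto
qed

lemma fixed_point_conservative_jacobian:
  fixes F :: "'p::euclidean_space \<times> 'z::euclidean_space \<Rightarrow> 'z"
  assumes \<Theta>: "open \<Theta>" and F: "locally_lipschitz_on (\<Theta> \<times> UNIV) F"
    and J: "conservative_jacobian_on (\<Theta> \<times> UNIV) F J" and q: "q < 1"
    and contr: "\<And>\<theta> z w. \<theta> \<in> \<Theta> \<Longrightarrow> norm (F (\<theta>, z) - F (\<theta>, w)) \<le> q * norm (z - w)"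
    and fp: "\<And>\<theta>. \<theta> \<in> \<Theta> \<Longrightarrow> F (\<theta>, zs \<theta>) = zs \<theta>"
    and cl: "\<And>x. x \<in> \<Theta> \<times> UNIV \<Longrightarrow> closed (clarke_jacobian (\<Theta> \<times> UNIV) F x)"
  shows "conservative_jacobian_on \<Theta> zs
    (\<lambda>\<theta>. implicit_jac ` clarke_jacobian (\<Theta> \<times> UNIV) F (\<theta>, zs \<theta>))"
proof -
  let ?D = "\<Theta> \<times> (UNIV :: 'z set)"
  let ?C = "clarke_jacobian ?D F"
  let ?J = "\<lambda>\<theta>. implicit_jac ` ?C (\<theta>, zs \<theta>)"
  have D: "open ?D" using \<Theta> by (intro open_Times) auto
  have mem: "(\<theta>, zs \<theta>) \<in> ?D" if "\<theta> \<in> \<Theta>" for \<theta> using that by simp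
  note con = clarke_jacobian_contraction[OF contr]
  have zs: "locally_lipschitz_on \<Theta> zs" by (rule fixed_point_locally_lipschitz[OF F q contr fp])
  have zs_cont: "continuous_on \<Theta> (\<lambda>\<theta>. (\<theta>, zs \<theta>))"
    by (intro continuous_intros locally_lipschitz_on_imp_continuous_on[OF zs])
  have C_graph: "closedin (top_of_set (?D \<times> UNIV)) {(x, M). x \<in> ?D \<and> M \<in> ?C x}"
    by (rule closed_graphI) (rule clarke_jacobian_limit[OF F D _ cl], auto)
  have nonempty: "?J \<theta> \<noteq> {}" if "\<theta> \<in> \<Theta>" for \<theta>
    using clarke_jacobian_nonempty[OF J F D mem[OF that]] by simp
  have bounded: "\<exists>e>0. \<exists>B. \<forall>w\<in>ball \<theta> e \<inter> \<Theta>. \<forall>M\<in>?J w. norm M \<le> B" if \<theta>: "\<theta> \<in> \<Theta>" for \<theta>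
  proof -
    obtain e B where e: "e > 0" and B: "\<And>x M. x \<in> ball (\<theta>, zs \<theta>) e \<inter> ?D \<Longrightarrow> M \<in> ?C x \<Longrightarrow> norm M \<le> B"
      using clarke_jacobian_locally_bounded[OF F D mem[OF \<theta>]] by blast
    obtain d where d: "d > 0" "\<And>w. w \<in> \<Theta> \<Longrightarrow> dist w \<theta> < d \<Longrightarrow> dist (w, zs w) (\<theta>, zs \<theta>) < e"
      using zs_cont \<theta> e unfolding continuous_on_iff by blast
    have "norm (implicit_jac M) \<le> B / (1 - q)" if w: "w \<in> ball \<theta> d \<inter> \<Theta>" and M: "M \<in> ?C (w, zs w)" for w M
    proof -
      have "(w, zs w) \<in> ball (\<theta>, zs \<theta>) e \<inter> ?D" using d(2)[of w] w by (simp add: dist_commute)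
      then have "norm M \<le> B" using B M by blast
      then have "norm M / (1 - q) \<le> B / (1 - q)" using q by (simp add: divide_right_mono)
      then show ?thesis using norm_implicit_jac_le[OF con[OF _ M] q] by simp
    qed
    then show ?thesis using d(1) by blast
  qed
  \<comment> \<open>The limit is taken in \<open>w = M (v, w)\<close>, and uniqueness of the
    solution identifies \<open>N'\<close>.\<close>
  have graph: "closedin (top_of_set (\<Theta> \<times> UNIV)) {(\<theta>, N). \<theta> \<in> \<Theta> \<and> N \<in> ?J \<theta>}"
  proof (rule closed_graphI)
    fix s N \<theta> and N' :: "'p \<Rightarrow>\<^sub>L 'z"
    assume s: "\<And>k. s k \<in> \<Theta>" "s \<longlonglongrightarrow> \<theta>" "\<theta> \<in> \<Theta>" and N: "\<And>k. N k \<in> ?J (s k)" "N \<longlonglongrightarrow> N'"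
    have "\<exists>M. M \<in> ?C (s k, zs (s k)) \<and> N k = implicit_jac M" for k using N(1)[of k] by blast
    then obtain M where M: "\<And>k. M k \<in> ?C (s k, zs (s k))" and NM: "\<And>k. N k = implicit_jac (M k)"
      by metis
    have "(\<lambda>k. (s k, zs (s k))) \<longlonglongrightarrow> (\<theta>, zs \<theta>)"
      using continuous_on_tendsto_compose[OF zs_cont s(2,3)] s(1) by simp
    then obtain P r where P: "P \<in> ?C (\<theta>, zs \<theta>)" "strict_mono r" "(M \<circ> r) \<longlonglongrightarrow> P"
      using closed_graph_subseq[OF clarke_jacobian_locally_bounded[OF F D mem[OF s(3)]] C_graph mem[OF s(3)],
        of "\<lambda>k. (s k, zs (s k))" M] mem[OF s(1)] M by blast
    have Nr: "(\<lambda>k. N (r k)) \<longlonglongrightarrow> N'" using LIMSEQ_subseq_LIMSEQ[OF N(2) P(2)] by (simp add: comp_def)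
    have Mr: "(\<lambda>k. M (r k)) \<longlonglongrightarrow> P" using P(3) by (simp add: comp_def)
    have "blinfun_apply N' v = blinfun_apply (implicit_jac P) v" for v
    proof (rule implicit_jac_unique[OF con[OF _ P(1)] q])
      have "(\<lambda>k. blinfun_apply (M (r k)) (v, blinfun_apply (N (r k)) v)) \<longlonglongrightarrow>
          blinfun_apply P (v, blinfun_apply N' v)"
        by (intro tendsto_intros Nr Mr)
      moreover have "blinfun_apply (M (r k)) (v, blinfun_apply (N (r k)) v) = blinfun_apply (N (r k)) v" for k
        using implicit_jac_fixed_point[OF con[OF _ M] q] unfolding NM by metis
      moreover have "(\<lambda>k. blinfun_apply (N (r k)) v) \<longlonglongrightarrow> blinfun_apply N' v"
        by (intro tendsto_intros Nr)
      ultimately show "blinfun_apply N' v = blinfun_apply P (v, blinfun_apply N' v)"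
        using LIMSEQ_unique by simp
    qed
    then have "N' = implicit_jac P" by (intro blinfun_eqI)
    then show "N' \<in> ?J \<theta>" using P(1) by blast
  qed
  have chain: "AE t in lborel. t \<in> {0..1} \<longrightarrow>
           (\<exists>c' d. (c has_vector_derivative c') (at t) \<and>
                   ((zs \<circ> c) has_vector_derivative d) (at t) \<and>
                   (\<forall>M\<in>?J (c t). d = blinfun_apply M c'))"
    if c: "abs_continuous_on {0..1} c" "c ` {0..1} \<subseteq> \<Theta>" for c
  proof -
    have "compact (c ` {0..1})"
      by (intro compact_continuous_image abs_continuous_on_imp_continuous_on c) simp
    then obtain L where "L-lipschitz_on (c ` {0..1}) zs"
      using locally_lipschitz_imp_lipschitz_on_compact[OF zs _ c(2)] by blast
    then have "(sqrt (1\<^sup>2 + L\<^sup>2))-lipschitz_on (c ` {0..1}) (\<lambda>\<theta>. (\<theta>, zs \<theta>))"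
      by (intro lipschitz_on_Pair lipschitz_on_id)
    then have ac: "abs_continuous_on {0..1} (\<lambda>t. (c t, zs (c t)))"
      by (rule abs_continuous_on_lipschitz_compose[OF c(1)])
    let ?c = "\<lambda>t. (c t, zs (c t))"
    have "AE t in lborel. t \<in> {0..1} \<longrightarrow>
           (\<exists>c' d. (?c has_vector_derivative c') (at t) \<and>
                   ((F \<circ> ?c) has_vector_derivative d) (at t) \<and>
                   (\<forall>M\<in>J (?c t). d = blinfun_apply M c'))"
      by (rule conservative_jacobian_chain[OF J ac]) (use c(2) in auto)
    \<comment> \<open>The fixed point identity is known along the curve only for parameters in
      \<open>{0..1}\<close>, so two-sided derivatives are transferred at interior points.\<close>
    moreover have "AE t in lborel. t \<noteq> (0::real)" "AE t in lborel. t \<noteq> (1::real)"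
      by (rule AE_lborel_singleton)+
    ultimately show ?thesis
    proof eventually_elim
      case (elim t)
      show ?case
      proof
        assume t: "t \<in> {0..1}"
        then obtain c' d where c': "(?c has_vector_derivative c') (at t)"
          and d: "((F \<circ> ?c) has_vector_derivative d) (at t)" and Jd: "\<forall>M\<in>J (?c t). d = blinfun_apply M c'"
          using elim by blast
        obtain a b where [simp]: "c' = (a, b)" by force
        have t': "t \<in> {0<..<1}" using t elim by auto
        have a: "(c has_vector_derivative a) (at t)"
          using bounded_linear.has_vector_derivative[OF bounded_linear_fst c'] by simp
        have b: "((\<lambda>t. zs (c t)) has_vector_derivative b) (at t)"
          using bounded_linear.has_vector_derivative[OF bounded_linear_snd c'] by simp
        have "((\<lambda>t. zs (c t)) has_vector_derivative d) (at t)"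
        proof (rule has_vector_derivative_transform_within_open[OF d open_greaterThanLessThan t'])
          fix u :: real assume "u \<in> {0<..<1}"
          then have "c u \<in> \<Theta>" using c(2) by auto
          then show "(F \<circ> ?c) u = zs (c u)" using fp by simp
        qed
        then have "b = d" using vector_derivative_unique_at[OF b] by blast
        have ct: "c t \<in> \<Theta>" using c(2) t by blast
        have "d = blinfun_apply (implicit_jac M) a" if M: "M \<in> ?C (?c t)" for M
        proof (rule implicit_jac_unique[OF con[OF _ M] q])
          have "blinfun_apply M (a, b) = d"
            by (rule clarke_jacobian_apply_eq[OF J F D mem[OF ct] _ M]) (use Jd in auto)
          then show "d = blinfun_apply M (a, d)" using \<open>b = d\<close> by simp
        qed
        then show "\<exists>c' d. (c has_vector_derivative c') (at t) \<and>
                   ((zs \<circ> c) has_vector_derivative d) (at t) \<and>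
                   (\<forall>M\<in>?J (c t). d = blinfun_apply M c')"
          using a b \<open>b = d\<close> by (intro exI[of _ a] exI[of _ d]) (auto simp: comp_def)
      qed
    qed
  qed
  show ?thesis
    unfolding conservative_jacobian_on_def using nonempty bounded graph chain by blast
qed

section \<open>Saddle points as fixed points of the resolvent\<close>

theorem theorem7:
  fixes \<Theta> :: "(real^'p) set" and X :: "(real^'n) set" and Y :: "(real^'m) set"
    and \<Phi> :: "real^'p \<Rightarrow> real^'n \<Rightarrow> real^'m \<Rightarrow> real"
    and \<alpha> \<gamma> :: real
    and T :: "real^'p \<Rightarrow> ((real^'n) \<times> (real^'m)) \<Rightarrow> ((real^'n) \<times> (real^'m))"
  assumes "\<Theta> \<noteq> {}" and "connected \<Theta>" and "open \<Theta>"
    and "X \<noteq> {}" and "closed X" and "convex X"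
    and "Y \<noteq> {}" and "convex Y" and "compact Y"
    and "\<alpha> > 0"
    and "\<And>\<theta>. \<theta> \<in> \<Theta> \<Longrightarrow> continuous_on UNIV (\<lambda>(x, y). \<Phi> \<theta> x y)"
    and "\<And>\<theta> y. \<theta> \<in> \<Theta> \<Longrightarrow> strongly_convex \<alpha> (\<lambda>x. \<Phi> \<theta> x y)"
    and "\<And>\<theta> x. \<theta> \<in> \<Theta> \<Longrightarrow> strongly_convex \<alpha> (\<lambda>y. - \<Phi> \<theta> x y)"
    and "\<And>x y. \<exists>L. L-lipschitz_on \<Theta> (\<lambda>\<theta>. \<Phi> \<theta> x y)"
    and "0 < \<gamma>" and "\<gamma> < 1 / \<alpha>"
    and T_def: "\<And>\<theta> z. T \<theta> z = resolvent_fun (scale_op \<gamma> (saddle_operator X Y (\<Phi> \<theta>))) z"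
    and "path_differentiable_on (\<Theta> \<times> UNIV) (\<lambda>(\<theta>, z). T \<theta> z)"
  shows "\<exists>zs :: real^'p \<Rightarrow> ((real^'n) \<times> (real^'m)).
           (\<forall>\<theta>\<in>\<Theta>. (\<forall>z. is_saddle_point X Y (\<Phi> \<theta>) z \<longleftrightarrow> z = zs \<theta>) \<and>
                     (\<forall>z. 0 \<in> saddle_operator X Y (\<Phi> \<theta>) z \<longleftrightarrow> z = zs \<theta>)) \<and>
           path_differentiable_on \<Theta> zs \<and>
           (\<forall>\<theta>\<in>\<Theta>. \<forall>M\<in>clarke_jacobian (\<Theta> \<times> UNIV) (\<lambda>(\<theta>', z). T \<theta>' z) (\<theta>, zs \<theta>).
               bij (blinfun_apply (id_blinfun - jac_block_V M))) \<and>
           conservative_jacobian_on \<Theta> zs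
             (\<lambda>\<theta>. implicit_jac ` clarke_jacobian (\<Theta> \<times> UNIV) (\<lambda>(\<theta>', z). T \<theta>' z) (\<theta>, zs \<theta>))"
proof -
  let ?F = "\<lambda>(\<theta>, z). T \<theta> z"
  let ?D = "\<Theta> \<times> (UNIV :: ((real^'n) \<times> (real^'m)) set)"
  let ?A = "\<lambda>\<theta>. saddle_operator X Y (\<Phi> \<theta>)"
  let ?R = "\<lambda>\<theta>. resolvent (scale_op \<gamma> (?A \<theta>))"
  note X = \<open>X \<noteq> {}\<close> \<open>closed X\<close> \<open>convex X\<close> and Y = \<open>Y \<noteq> {}\<close> \<open>compact Y\<close> \<open>convex Y\<close>
  note cont = assms(11) and cx = assms(12) and cy = assms(13)
  \<comment> \<open>The reciprocal of the expansion constant that strong monotonicity gives to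
    \<open>Id + \<gamma> A\<close>.\<close>
  define q where "q = 1 / (1 + \<gamma> * \<alpha>)"
  have g: "\<gamma> * \<alpha> > 0" using \<open>\<alpha> > 0\<close> \<open>0 < \<gamma>\<close> by simp
  have q: "q < 1" using g by (simp add: q_def)
  have mono: "norm (w - w') \<le> q * norm (z - z')"
    if "\<theta> \<in> \<Theta>" "w \<in> ?R \<theta> z" "w' \<in> ?R \<theta> z'" for \<theta> w w' z z'
  proof -
    have "norm (w - w') * (1 + \<gamma> * \<alpha>) \<le> norm (z - z')"
      using saddle_resolvent_strongly_monotone[OF cx[OF that(1)] cy[OF that(1)] \<open>0 < \<gamma>\<close> that(2,3)]
      by (simp add: mult.commute)
    then have "norm (w - w') \<le> norm (z - z') / (1 + \<gamma> * \<alpha>)" using g by (subst pos_le_divide_eq) auto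
    then show ?thesis by (simp add: q_def)
  qed
  have R_unique: "w = w'" if "\<theta> \<in> \<Theta>" "w \<in> ?R \<theta> z" "w' \<in> ?R \<theta> z" for \<theta> w w' z
    using mono[OF that] by simp
  have T_in: "T \<theta> z \<in> ?R \<theta> z" if "\<theta> \<in> \<Theta>" for \<theta> z
  proof -
    have "\<exists>w. w \<in> ?R \<theta> z"
      by (rule saddle_resolvent_exists[OF X Y \<open>\<alpha> > 0\<close> cont[OF that] cx[OF that] cy[OF that] \<open>0 < \<gamma>\<close>])
    \<comment> \<open>The description in \<open>resolvent_fun\<close> denotes the resolvent value
      once existence and uniqueness are known.\<close>
    then have "\<exists>!w. w \<in> ?R \<theta> z" using R_unique[OF that] by blast
    then show ?thesis unfolding T_def resolvent_fun_def by (rule theI')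
  qed
  have contr: "norm (?F (\<theta>, z) - ?F (\<theta>, w)) \<le> q * norm (z - w)" if "\<theta> \<in> \<Theta>" for \<theta> z w
    using mono[OF that T_in[OF that] T_in[OF that]] by simp
  have zero_iff: "0 \<in> ?A \<theta> z \<longleftrightarrow> is_saddle_point X Y (\<Phi> \<theta>) z" if "\<theta> \<in> \<Theta>" for \<theta> z
    using \<open>\<alpha> > 0\<close>
    by (intro zero_in_saddle_operator_iff X Y strongly_convex_imp_convex[OF cx[OF that]]
      strongly_convex_imp_convex[OF cy[OF that]]) auto
  have "\<exists>z. is_saddle_point X Y (\<Phi> \<theta>) z" if "\<theta> \<in> \<Theta>" for \<theta>
    using saddle_point_exists[OF X Y \<open>\<alpha> > 0\<close> cont[OF that] cx[OF that] cy[OF that]] by blast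
  then obtain zs where zs: "\<And>\<theta>. \<theta> \<in> \<Theta> \<Longrightarrow> is_saddle_point X Y (\<Phi> \<theta>) (zs \<theta>)" by metis
  \<comment> \<open>With \<open>a = 0\<close> the resolvent equation reads \<open>z = z\<close>, so
    zeros of the operator are fixed points of \<open>T \<theta>\<close>.\<close>
  have in_R: "z \<in> ?R \<theta> z" if "0 \<in> ?A \<theta> z" for \<theta> z
  proof -
    have "0 \<in> scale_op \<gamma> (?A \<theta>) z" unfolding scale_op_def using that by (metis image_eqI scaleR_zero_right)
    then show ?thesis unfolding resolvent_def by force
  qed
  have fp: "?F (\<theta>, zs \<theta>) = zs \<theta>" if "\<theta> \<in> \<Theta>" for \<theta>
    using R_unique[OF that T_in[OF that] in_R] zero_iff[OF that] zs[OF that] by simp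
  have uniq: "z = zs \<theta>" if "\<theta> \<in> \<Theta>" "0 \<in> ?A \<theta> z" for \<theta> z
  proof -
    have "0 \<in> ?A \<theta> (zs \<theta>)" using zero_iff zs that by simp
    from saddle_operator_strongly_monotone[OF cx[OF that(1)] cy[OF that(1)] that(2) this]
    have "\<alpha> * (norm (z - zs \<theta>))\<^sup>2 \<le> 0" by simp
    then show ?thesis using \<open>\<alpha> > 0\<close> by (simp add: mult_le_0_iff)
  qed
  obtain J where J: "conservative_jacobian_on ?D ?F J" and F: "locally_lipschitz_on ?D ?F"
    using assms(18) unfolding path_differentiable_on_def by blast
  have D: "open ?D" using \<open>open \<Theta>\<close> by (intro open_Times) auto
  obtain f :: "(((real^'p) \<times> (real^'n) \<times> (real^'m)) \<Rightarrow>\<^sub>L ((real^'n) \<times> (real^'m))) \<Rightarrow>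
      (((real^'n) \<times> (real^'m))^'p) \<times> (((real^'n) \<times> (real^'m))^'n) \<times> (((real^'n) \<times> (real^'m))^'m)"
    where f: "linear f" "continuous_on UNIV f" "inj f"
    by (rule blinfun_cart_embedding)
  have cons: "conservative_jacobian_on \<Theta> zs
      (\<lambda>\<theta>. implicit_jac ` clarke_jacobian ?D ?F (\<theta>, zs \<theta>))"
    using clarke_jacobian_closed[OF f F D]
    by (intro fixed_point_conservative_jacobian[OF \<open>open \<Theta>\<close> F J q contr fp])
  have "locally_lipschitz_on \<Theta> zs" by (rule fixed_point_locally_lipschitz[OF F q contr fp])
  then have "path_differentiable_on \<Theta> zs" unfolding path_differentiable_on_def using cons by blast
  moreover have "bij (blinfun_apply (id_blinfun - jac_block_V M))"
    if "M \<in> clarke_jacobian ?D ?F (\<theta>, zs \<theta>)" for \<theta> M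
    by (rule bij_id_minus_jac_block_V[OF clarke_jacobian_contraction[OF contr that] q])
  ultimately show ?thesis
    using cons zero_iff uniq zs by (intro exI[of _ zs]) blast
qed

end
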